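(* Let $n\ge 5$ with $n\not\equiv 0 \pmod 3$. Every orbifold solution for the cells of $\mathcal{D}^{(n)}$ is equivalent to the solution in which the value of the cell on each triangle of $\mathcal{D}^{(n)}$ equals the value of the corresponding cell in $\mathcal{A}^{(n)}$ given by $$W_{\triangle(k,m)}=\frac{\sqrt{[k+1][k+2][m+1][m+2][k+m+2][k+m+3]}}{[2]},\qquad W_{\nabla(k,m)}=\frac{\sqrt{[k+1][k+2][m+1][m+2][k+m+3][k+m+4]}}{[2]}.$$
   Context: Let $q=e^{\pi i/n}$ and $[m]=(q^m-q^{-m})/(q-q^{-1})$. The graph $\mathcal{A}^{(n)}$ has vertices $(\lambda_1,\lambda_2)$, $\lambda_1,\lambda_2\ge 0$ integers with $\lambda_1+\lambda_2\le n-3$, and directed edges $(\lambda_1,\lambda_2)\to(\lambda_1+1,\lambda_2)$, $(\lambda_1-1,\lambda_2+1)$, $(\lambda_1,\lambda_2-1)$ whenever the target is a vertex. Its Perron-Frobenius eigenvector (eigenvalue $[3]$) is $\phi_{(\lambda_1,\lambda_2)}=[\lambda_1+1][\lambda_2+1][\lambda_1+\lambda_2+2]/[2]$. $\triangle(k,m)$ is the triangle $(k,m)\to(k+1,m)\to(k,m+1)\to(k,m)$ and $\nabla(k,m)$ is the triangle $(k+1,m)\to(k,m+1)\to(k+1,m+1)\to(k+1,m)$. The rotation $(\lambda_1,\lambda_2)\mapsto(n-3-\lambda_1-\lambda_2,\lambda_1)$ generates a $\mathbb{Z}_3$-action on $\mathcal{A}^{(n)}$ preserving $\phi$ and the cell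 values $W_{\triangle(k,m)}=\sqrt{[k+1][k+2][m+1][m+2][k+m+2][k+m+3]}/[2]$ on the triangles $\triangle(k,m)$ and $W_{\nabla(k,m)}=\sqrt{[k+1][k+2][m+1][m+2][k+m+3][k+m+4]}/[2]$ on the triangles $\nabla(k,m)$ of $\mathcal{A}^{(n)}$. For $n\not\equiv 0\pmod 3$ the action on vertices is free, and $\mathcal{D}^{(n)}$ is the quotient ($\mathbb{Z}_3$ orbifold) graph: vertices and edges are the orbits of vertices and edges of $\mathcal{A}^{(n)}$; its eigenvector takes on each orbit the value of $\phi$ on any representative. Each triangle of $\mathcal{D}^{(n)}$ is the image of triangles of $\mathcal{A}^{(n)}$ (a single $\mathbb{Z}_3$-orbit), the corresponding triangles. An orbifold solution is a cell system $W$ on $\mathcal{D}^{(n)}$ such that the absolute value of $W$ on each triangle equals that of the corresponding cell of $\mathcal{A}^{(n)}$ given in the claim. Cell systems: let $\mathcal{G}$ be a directed graph (loops and multiple edges allowed), with source and range maps $s,r$, Perron-Frobenius eigenvalue $[3]$ and positive Perron-Frobenius eigenvector $(\phi_i)$. A triangle $\triangle_{ijk}^{(\alpha\beta\gamma)}$ is a closed path $i\xrightarrow{\alpha}j\xrightarrow{\beta}k\xrightarrow{\gamma}i$, considered up to cyclic rotation. A cell system $W$ assigns to each triangle a complex number $W(\triangle_{ijk}^{(\alpha\beta\gamma)})$ such that: (I) for all edges $\alpha,\alpha'$ from $i$ to $j$, $\sum_{k,\beta,\gamma}W(\triangle_{ijk}^{(\alpha\beta\gamma)})\overline{W(\triangle_{ijk}^{(\alpha'\beta\gamma)})}=\delta_{\alpha,\alpha'}[2]\phi_i\phi_j$,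 the sum being over vertices $k$ and edges $\beta:j\to k$, $\gamma:k\to i$; (II) for all edges $\alpha_1,\dots,\alpha_4$ with $s(\alpha_1)=s(\alpha_4)=i_1$, $r(\alpha_1)=r(\alpha_2)=i_2$, $s(\alpha_2)=s(\alpha_3)=i_3$, $r(\alpha_3)=r(\alpha_4)=i_4$, $$\sum\phi_k^{-1}W(\triangle_{i_1i_2k}^{(\alpha_1\beta_1\beta_2)})\overline{W(\triangle_{i_3i_2k}^{(\alpha_2\beta_1\beta_3)})}W(\triangle_{i_3i_4k}^{(\alpha_3\beta_4\beta_3)})\overline{W(\triangle_{i_1i_4k}^{(\alpha_4\beta_4\beta_2)})}=\delta_{\alpha_1,\alpha_4}\delta_{\alpha_2,\alpha_3}\phi_{i_1}\phi_{i_2}\phi_{i_3}+\delta_{\alpha_1,\alpha_2}\delta_{\alpha_3,\alpha_4}\phi_{i_1}\phi_{i_2}\phi_{i_4},$$ the sum being over vertices $k$ and edges $\beta_1:i_2\to k$, $\beta_2:k\to i_1$, $\beta_3:k\to i_3$, $\beta_4:i_4\to k$. Two cell systems $W_1,W_2$ on $\mathcal{G}$ are equivalent if for each pair of adjacent vertices $i,j$ there is a unitary matrix $(u(\sigma,\sigma'))$ indexed by the edges from $i$ to $j$ such that for every triangle $W_1(\triangle_{ijk}^{(\sigma\rho\gamma)})=\sum_{\sigma',\rho',\gamma'}u(\sigma,\sigma')u(\rho,\rho')u(\gamma,\gamma')W_2(\triangle_{ijk}^{(\sigma'\rho'\gamma')})$, summing over edges $\sigma':i\to j$, $\rho':j\to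 k$, $\gamma':k\to i$. *)

theory Defs
  imports
    Complex_Main
    "HOL-Combinatorics.Orbits"
    "Graph_Theory.Digraph"
begin

section \<open>Quantum integers\<close>

definition qroot :: "nat \<Rightarrow> complex" where
  "qroot n = exp (complex_of_real pi * \<i> / of_nat n)"

text \<open>The quotient is real (see \<open>qint_complex\<close>); the real part only changes the type, so that
  quantum integers can be compared and square roots of their products taken in the reals.\<close>

definition qint :: "nat \<Rightarrow> nat \<Rightarrow> real" where
  "qint n m = Re ((qroot n ^ m - inverse (qroot n) ^ m) / (qroot n - inverse (qroot n)))"

lemma qroot_cis: "qroot n = cis (pi / real n)"
  by (simp add: qroot_def cis_conv_exp mult.commute)

lemma qroot_power_diff:
  "qroot n ^ m - inverse (qroot n) ^ m = 2 * \<i> * complex_of_real (sin (real m * (pi / real n)))"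
  by (simp add: qroot_cis DeMoivre complex_eq_iff)

lemma qint_complex:
  "complex_of_real (qint n m)
     = (qroot n ^ m - inverse (qroot n) ^ m) / (qroot n - inverse (qroot n))"
proof -
  have "(qroot n ^ m - inverse (qroot n) ^ m) / (qroot n - inverse (qroot n))
      = complex_of_real (sin (real m * (pi / real n)) / sin (pi / real n))"
    using qroot_power_diff[of n m] qroot_power_diff[of n 1] by simp
  then show ?thesis by (simp add: qint_def)
qed


section \<open>Cell systems\<close>

text \<open>Graphs are finite directed multigraphs, loops allowed. A function on triangles is a function
  of three arcs \<open>\<alpha> \<beta> \<gamma>\<close>, of which only the values on closed paths \<open>i \<rightarrow> j \<rightarrow> k \<rightarrow> i\<close> matter;
  that a triangle is taken up to cyclic rotation becomes rotation invariance of the function.\<close>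

definition arcs_between :: "('a, 'b) pre_digraph \<Rightarrow> 'a \<Rightarrow> 'a \<Rightarrow> 'b set" where
  "arcs_between G i j = {e \<in> arcs G. tail G e = i \<and> head G e = j}"

definition triangle :: "('a, 'b) pre_digraph \<Rightarrow> 'b \<Rightarrow> 'b \<Rightarrow> 'b \<Rightarrow> bool" where
  "triangle G \<alpha> \<beta> \<gamma> \<longleftrightarrow> \<alpha> \<in> arcs G \<and> \<beta> \<in> arcs G \<and> \<gamma> \<in> arcs G \<and>
     head G \<alpha> = tail G \<beta> \<and> head G \<beta> = tail G \<gamma> \<and> head G \<gamma> = tail G \<alpha>"

definition rotation_invariant ::
    "('a, 'b) pre_digraph \<Rightarrow> ('b \<Rightarrow> 'b \<Rightarrow> 'b \<Rightarrow> complex) \<Rightarrow> bool" where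
  "rotation_invariant G W \<longleftrightarrow> (\<forall>\<alpha> \<beta> \<gamma>. triangle G \<alpha> \<beta> \<gamma> \<longrightarrow> W \<alpha> \<beta> \<gamma> = W \<beta> \<gamma> \<alpha>)"

definition type_I ::
    "nat \<Rightarrow> ('a, 'b) pre_digraph \<Rightarrow> ('a \<Rightarrow> real) \<Rightarrow> ('b \<Rightarrow> 'b \<Rightarrow> 'b \<Rightarrow> complex) \<Rightarrow> bool" where
  "type_I n G \<phi> W \<longleftrightarrow>
     (\<forall>i\<in>verts G. \<forall>j\<in>verts G. \<forall>\<alpha>\<in>arcs_between G i j. \<forall>\<alpha>'\<in>arcs_between G i j.
        (\<Sum>k\<in>verts G. \<Sum>\<beta>\<in>arcs_between G j k. \<Sum>\<gamma>\<in>arcs_between G k i.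
            W \<alpha> \<beta> \<gamma> * cnj (W \<alpha>' \<beta> \<gamma>))
        = of_bool (\<alpha> = \<alpha>') * complex_of_real (qint n 2 * \<phi> i * \<phi> j))"

definition type_II ::
    "('a, 'b) pre_digraph \<Rightarrow> ('a \<Rightarrow> real) \<Rightarrow> ('b \<Rightarrow> 'b \<Rightarrow> 'b \<Rightarrow> complex) \<Rightarrow> bool" where
  "type_II G \<phi> W \<longleftrightarrow>
     (\<forall>i1\<in>verts G. \<forall>i2\<in>verts G. \<forall>i3\<in>verts G. \<forall>i4\<in>verts G.
      \<forall>\<alpha>1\<in>arcs_between G i1 i2. \<forall>\<alpha>2\<in>arcs_between G i3 i2.
      \<forall>\<alpha>3\<in>arcs_between G i3 i4. \<forall>\<alpha>4\<in>arcs_between G i1 i4.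
        (\<Sum>k\<in>verts G. \<Sum>\<beta>1\<in>arcs_between G i2 k. \<Sum>\<beta>2\<in>arcs_between G k i1.
         \<Sum>\<beta>3\<in>arcs_between G k i3. \<Sum>\<beta>4\<in>arcs_between G i4 k.
            complex_of_real (inverse (\<phi> k)) *
            W \<alpha>1 \<beta>1 \<beta>2 * cnj (W \<alpha>2 \<beta>1 \<beta>3) * W \<alpha>3 \<beta>4 \<beta>3 * cnj (W \<alpha>4 \<beta>4 \<beta>2))
        = of_bool (\<alpha>1 = \<alpha>4) * of_bool (\<alpha>2 = \<alpha>3) * complex_of_real (\<phi> i1 * \<phi> i2 * \<phi> i3)
        + of_bool (\<alpha>1 = \<alpha>2) * of_bool (\<alpha>3 = \<alpha>4) * complex_of_real (\<phi> i1 * \<phi> i2 * \<phi> i4))"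

text \<open>Here \<open>\<phi>\<close> is meant to be a positive Perron-Frobenius eigenvector of \<open>G\<close> for the eigenvalue
  \<open>qint n 3\<close>; its normalization matters.\<close>

definition cell_system ::
    "nat \<Rightarrow> ('a, 'b) pre_digraph \<Rightarrow> ('a \<Rightarrow> real) \<Rightarrow> ('b \<Rightarrow> 'b \<Rightarrow> 'b \<Rightarrow> complex) \<Rightarrow> bool" where
  "cell_system n G \<phi> W \<longleftrightarrow> rotation_invariant G W \<and> type_I n G \<phi> W \<and> type_II G \<phi> W"

definition unitary_on :: "'b set \<Rightarrow> ('b \<Rightarrow> 'b \<Rightarrow> complex) \<Rightarrow> bool" where
  "unitary_on E u \<longleftrightarrow> (\<forall>\<sigma>\<in>E. \<forall>\<tau>\<in>E.
     (\<Sum>\<rho>\<in>E. u \<sigma> \<rho> * cnj (u \<tau> \<rho>)) = of_bool (\<sigma> = \<tau>) \<and>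
     (\<Sum>\<rho>\<in>E. cnj (u \<rho> \<sigma>) * u \<rho> \<tau>) = of_bool (\<sigma> = \<tau>))"

text \<open>The unitaries for the various pairs \<open>(i, j)\<close> are the blocks of a single \<open>u\<close>: the index sets
  \<open>arcs_between G i j\<close> are pairwise disjoint.\<close>

definition equivalent_cells ::
    "('a, 'b) pre_digraph \<Rightarrow> ('b \<Rightarrow> 'b \<Rightarrow> 'b \<Rightarrow> complex) \<Rightarrow> ('b \<Rightarrow> 'b \<Rightarrow> 'b \<Rightarrow> complex) \<Rightarrow> bool" where
  "equivalent_cells G W1 W2 \<longleftrightarrow>
     (\<exists>u. (\<forall>i\<in>verts G. \<forall>j\<in>verts G. unitary_on (arcs_between G i j) u) \<and>
       (\<forall>i\<in>verts G. \<forall>j\<in>verts G. \<forall>k\<in>verts G.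
        \<forall>\<sigma>\<in>arcs_between G i j. \<forall>\<rho>\<in>arcs_between G j k. \<forall>\<gamma>\<in>arcs_between G k i.
          W1 \<sigma> \<rho> \<gamma> =
            (\<Sum>\<sigma>'\<in>arcs_between G i j. \<Sum>\<rho>'\<in>arcs_between G j k. \<Sum>\<gamma>'\<in>arcs_between G k i.
               u \<sigma> \<sigma>' * u \<rho> \<rho>' * u \<gamma> \<gamma>' * W2 \<sigma>' \<rho>' \<gamma>')))"


section \<open>The graph \<open>A\<close>\<close>

type_synonym vertex = "nat \<times> nat"
type_synonym edge = "vertex \<times> vertex"

definition A_verts :: "nat \<Rightarrow> vertex set" where
  "A_verts n = {(a, b). a + b + 3 \<le> n}"

text \<open>The targets \<open>(a + 1, b)\<close>, \<open>(a - 1, b + 1)\<close>, \<open>(a, b - 1)\<close>, written without subtraction.\<close>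

definition A_arcs :: "nat \<Rightarrow> edge set" where
  "A_arcs n = {((a, b), (c, d)). (a, b) \<in> A_verts n \<and> (c, d) \<in> A_verts n \<and>
     (c = a + 1 \<and> d = b \<or> c + 1 = a \<and> d = b + 1 \<or> c = a \<and> d + 1 = b)}"

definition A_graph :: "nat \<Rightarrow> (vertex, edge) pre_digraph" where
  "A_graph n = \<lparr>verts = A_verts n, arcs = A_arcs n, tail = fst, head = snd\<rparr>"

fun A_eigenvector :: "nat \<Rightarrow> vertex \<Rightarrow> real" where
  "A_eigenvector n (a, b) = qint n (a + 1) * qint n (b + 1) * qint n (a + b + 2) / qint n 2"

definition W_up :: "nat \<Rightarrow> nat \<Rightarrow> nat \<Rightarrow> real" where
  "W_up n k m = sqrt (qint n (k + 1) * qint n (k + 2) * qint n (m + 1) * qint n (m + 2) *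
                      qint n (k + m + 2) * qint n (k + m + 3)) / qint n 2"

definition W_down :: "nat \<Rightarrow> nat \<Rightarrow> nat \<Rightarrow> real" where
  "W_down n k m = sqrt (qint n (k + 1) * qint n (k + 2) * qint n (m + 1) * qint n (m + 2) *
                        qint n (k + m + 3) * qint n (k + m + 4)) / qint n 2"

text \<open>\<open>A_cell n a b c w\<close>: the triangle with arcs \<open>a\<close>, \<open>b\<close>, \<open>c\<close> has cell value \<open>w\<close>. Every triangle
  is a rotation of exactly one upward triangle (rule \<open>up\<close>) or downward triangle (rule \<open>down\<close>).\<close>

inductive A_cell :: "nat \<Rightarrow> edge \<Rightarrow> edge \<Rightarrow> edge \<Rightarrow> real \<Rightarrow> bool" for n where
  up: "triangle (A_graph n)
         ((k, m), (k + 1, m)) ((k + 1, m), (k, m + 1)) ((k, m + 1), (k, m)) \<Longrightarrow>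
       A_cell n ((k, m), (k + 1, m)) ((k + 1, m), (k, m + 1)) ((k, m + 1), (k, m)) (W_up n k m)"
| down: "triangle (A_graph n)
         ((k + 1, m), (k, m + 1)) ((k, m + 1), (k + 1, m + 1)) ((k + 1, m + 1), (k + 1, m)) \<Longrightarrow>
       A_cell n ((k + 1, m), (k, m + 1)) ((k, m + 1), (k + 1, m + 1)) ((k + 1, m + 1), (k + 1, m))
         (W_down n k m)"
| rotate: "A_cell n a b c w \<Longrightarrow> A_cell n b c a w"


section \<open>The orbifold graph \<open>D\<close>\<close>

text \<open>On \<open>A_verts n\<close> the subtraction does not truncate, and \<open>rot n\<close> is a permutation with third
  power the identity, so the library's \<open>orbit\<close> of a vertex or an arc is its orbit under the
  \<open>Z/3\<close>-action, the starting point included.\<close>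

fun rot :: "nat \<Rightarrow> vertex \<Rightarrow> vertex" where
  "rot n (a, b) = (n - 3 - a - b, a)"

definition vertex_orbit :: "nat \<Rightarrow> vertex \<Rightarrow> vertex set" where
  "vertex_orbit n x = orbit (rot n) x"

definition edge_orbit :: "nat \<Rightarrow> edge \<Rightarrow> edge set" where
  "edge_orbit n e = orbit (map_prod (rot n) (rot n)) e"

text \<open>The image under \<open>fst\<close> (\<open>snd\<close>) of the orbit of an arc is the orbit of its source (range).\<close>

definition D_graph :: "nat \<Rightarrow> (vertex set, edge set) pre_digraph" where
  "D_graph n = \<lparr>verts = vertex_orbit n ` A_verts n, arcs = edge_orbit n ` A_arcs n,
                tail = (`) fst, head = (`) snd\<rparr>"

definition D_eigenvector :: "nat \<Rightarrow> vertex set \<Rightarrow> real" where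
  "D_eigenvector n v = A_eigenvector n (SOME x. x \<in> v)"

text \<open>\<open>D_cell_value n \<alpha> \<beta> \<gamma> w\<close>: some triangle of \<open>A\<close> over the triangle \<open>\<alpha>\<close>, \<open>\<beta>\<close>, \<open>\<gamma>\<close> of \<open>D\<close> has
  cell value \<open>w\<close>. As the action preserves the cell values, \<open>w\<close> is unique.\<close>

definition D_cell_value :: "nat \<Rightarrow> edge set \<Rightarrow> edge set \<Rightarrow> edge set \<Rightarrow> real \<Rightarrow> bool" where
  "D_cell_value n \<alpha> \<beta> \<gamma> w \<longleftrightarrow>
     (\<exists>a b c. A_cell n a b c w \<and> \<alpha> = edge_orbit n a \<and> \<beta> = edge_orbit n b \<and> \<gamma> = edge_orbit n c)"

definition orbifold_solution ::
    "nat \<Rightarrow> (edge set \<Rightarrow> edge set \<Rightarrow> edge set \<Rightarrow> complex) \<Rightarrow> bool" where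
  "orbifold_solution n W \<longleftrightarrow>
     cell_system n (D_graph n) (D_eigenvector n) W \<and>
     (\<forall>\<alpha> \<beta> \<gamma> w. triangle (D_graph n) \<alpha> \<beta> \<gamma> \<and> D_cell_value n \<alpha> \<beta> \<gamma> w \<longrightarrow> cmod (W \<alpha> \<beta> \<gamma>) = w)"

definition D_cell :: "nat \<Rightarrow> edge set \<Rightarrow> edge set \<Rightarrow> edge set \<Rightarrow> complex" where
  "D_cell n \<alpha> \<beta> \<gamma> = complex_of_real (THE w. D_cell_value n \<alpha> \<beta> \<gamma> w)"

end

theory Submission
  imports Defs
begin

text \<open>
  An orbifold solution is determined by its absolute values up to phases on triangles, so there are
  two things to show: that the positive values satisfy the cell equations, and that arbitrary phases
  on the triangles can be removed by a gauge transformation.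

  For the first part, colour the vertex \<open>(a, b)\<close> of the triangle graph by \<open>a + 2 b\<close> modulo 3. Arcs
  raise the colour by one, and the generator of the \<open>Z/3\<close>-action raises it by \<open>n\<close>, so for \<open>n\<close> not
  divisible by 3 a vertex of the quotient has exactly one lift of each colour. Consequently the
  quotient has no multiple arcs, and every configuration in the cell equations lifts, with unique
  colours, to the triangle graph (\<open>arcs_between_orbits\<close>, \<open>sum_orbits\<close>). One arc can be assumed to be
  horizontal. Then each sum has at most two terms, and the equations
  (\<open>horizontal_type_I\<close>, \<open>horizontal_type_II\<close>) reduce to the identity
  \<open>[b + 1] [b + d] - [b] [b + d + 1] = [d]\<close> of quantum integers.

  The second part uses only that the absolute values are the prescribed ones. The triangle is a disc
  and its quotient is a disc with a cone point, which lies inside the central triangle: the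
  rotation fixes no vertex, and this triangle is mapped to one whose three arcs are the same loop. On a
  disc every function from triangles to the unit circle is a product of phases on the arcs. To get
  such phases, start with the central triangle, where a cube root is needed, and work outwards: every
  other triangle has an arc on its outer side whose phase is still free when the triangle is
  reached (\<open>peeling_phases\<close>, \<open>phases_on_triples\<close>). As the quotient has no multiple arcs, these
  phases are the required unitary matrices (\<open>equivalent_to_D_cell\<close>).
\<close>

section \<open>Quantum integers\<close>

lemma qint_sin: "qint n m = sin (real m * (pi / real n)) / sin (pi / real n)"
proof -
  have "complex_of_real (qint n m)
      = complex_of_real (sin (real m * (pi / real n)) / sin (pi / real n))"
    unfolding qint_complex using qroot_power_diff[of n m] qroot_power_diff[of n 1] by simp
  then show ?thesis by (simp only: of_real_eq_iff)
qed

lemma qint_0 [simp]: "qint n 0 = 0"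
  by (simp add: qint_sin)

lemma qint_pos: "0 < m \<Longrightarrow> m < n \<Longrightarrow> qint n m > 0"
  unfolding qint_sin by (intro divide_pos_pos sin_gt_zero) (auto simp: field_simps)

lemma qint_reflect:
  assumes "m \<le> n" "0 < n"
  shows "qint n (n - m) = qint n m"
proof -
  have "real (n - m) * (pi / real n) = pi - real m * (pi / real n)"
    using assms by (simp add: of_nat_diff field_simps)
  then show ?thesis by (simp add: qint_sin)
qed

lemma qint_nonneg: "m \<le> n \<Longrightarrow> qint n m \<ge> 0"
  using qint_pos[of m n] qint_reflect[of n n] by (cases "m = 0"; cases "m = n") auto

text \<open>
  This is the addition formula for sines in the form in which all cancellations in the cell
  equations happen.
\<close>

lemma qint_cross:
  assumes "n \<ge> 2"
  shows "qint n (b + 1) * qint n (b + d) = qint n b * qint n (b + d + 1) + qint n d"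
proof -
  define t where "t = pi / real n"
  have "0 < t" "t < pi" using assms by (auto simp: t_def field_simps)
  then have "sin t > 0" by (rule sin_gt_zero)
  have "sin ((b + 1) * t) * sin ((b + d) * t) = sin (b * t) * sin ((b + d + 1) * t) + sin t * sin (d * t)"
  proof -
    have "(b + 1) * t - (b + d) * t = t - d * t" "(b + 1) * t + (b + d) * t = (2 * b + d + 1) * t"
      "b * t - (b + d + 1) * t = - (t + d * t)" "b * t + (b + d + 1) * t = (2 * b + d + 1) * t"
      by (simp_all add: algebra_simps)
    then show ?thesis unfolding sin_times_sin by (simp only: cos_minus) (simp add: field_simps)
  qed
  then show ?thesis
    using \<open>sin t > 0\<close> by (simp add: qint_sin flip: t_def) (simp add: field_simps)
qed

lemma qint_1: "n \<ge> 2 \<Longrightarrow> qint n 1 = 1"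
  using qint_pos[of 1 n] by (simp add: qint_sin split: if_splits)

lemma qint_2_mult: "n \<ge> 2 \<Longrightarrow> qint n 2 * qint n (m + 1) = qint n m + qint n (m + 2)"
  using qint_cross[of n 1 m] qint_1[of n] by (simp add: numeral_2_eq_2)

section \<open>Colours and rotation\<close>

text \<open>
  Every arc raises the colour by one, and the rotation raises it by \<open>n\<close>. For \<open>n\<close> not divisible by 3
  the three vertices of an orbit therefore have the three different colours, so that a vertex of the
  quotient lifts uniquely once a colour has been prescribed.
\<close>

fun colour :: "vertex \<Rightarrow> nat" where
  "colour (a, b) = (a + 2 * b) mod 3"

lemma colour_arc: "(x, y) \<in> A_arcs n \<Longrightarrow> colour y = (colour x + 1) mod 3"
proof -
  have *: "(a + 2 * (b + 1)) mod 3 = (a + 2 + 2 * b) mod 3" for a b :: nat by simp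
  show "(x, y) \<in> A_arcs n \<Longrightarrow> colour y = (colour x + 1) mod 3"
    by (cases x; cases y) (auto simp: A_arcs_def mod_simps; presburger)
qed

lemma colour_rot: "x \<in> A_verts n \<Longrightarrow> colour (rot n x) = (colour x + n) mod 3"
proof -
  assume x: "x \<in> A_verts n"
  obtain a b where ab: "x = (a, b)" by (cases x)
  obtain c where n: "n = a + b + 3 + c" using x unfolding ab A_verts_def by (auto simp: le_iff_add)
  have "(a + 2 * b + n) mod 3 = (c + 2 * a + 3 * (b + 1)) mod 3"
    unfolding n by (rule arg_cong[where f = "\<lambda>k. k mod 3"]) simp
  also have "\<dots> = (c + 2 * a) mod 3" by (rule mod_mult_self2)
  finally have "(a + 2 * b + n) mod 3 = (c + 2 * a) mod 3" .
  moreover have "rot n (a, b) = (c, a)" using n by simp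
  ultimately show ?thesis unfolding ab by (simp add: mod_add_left_eq)
qed

lemma rot_in_verts: "x \<in> A_verts n \<Longrightarrow> rot n x \<in> A_verts n"
  by (cases x) (auto simp: A_verts_def)

lemma rot_rot_rot: "x \<in> A_verts n \<Longrightarrow> rot n (rot n (rot n x)) = x"
  by (cases x) (auto simp: A_verts_def)

lemma A_arcs_verts: "(x, y) \<in> A_arcs n \<Longrightarrow> x \<in> A_verts n \<and> y \<in> A_verts n"
  by (auto simp: A_arcs_def)

lemma rot_in_arcs: "(x, y) \<in> A_arcs n \<Longrightarrow> (rot n x, rot n y) \<in> A_arcs n"
  by (cases x; cases y) (auto simp: A_arcs_def A_verts_def)

lemma finite_A_verts: "finite (A_verts n)"
  by (rule finite_subset[of _ "{..n} \<times> {..n}"]) (auto simp: A_verts_def)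

declare rot.simps [simp del] colour.simps [simp del]

lemma orbit_period_3:
  assumes "f (f (f x)) = x"
  shows "orbit f x = {x, f x, f (f x)}"
proof
  show "orbit f x \<subseteq> {x, f x, f (f x)}"
  proof
    fix y assume "y \<in> orbit f x"
    then show "y \<in> {x, f x, f (f x)}" by induction (auto simp: assms)
  qed
  have "f x \<in> orbit f x" by (rule orbit.base)
  moreover from this have "f (f x) \<in> orbit f x" by (rule orbit.step)
  moreover from this have "f (f (f x)) \<in> orbit f x" by (rule orbit.step)
  ultimately show "{x, f x, f (f x)} \<subseteq> orbit f x" by (simp add: assms)
qed

lemma vertex_orbit_eq: "x \<in> A_verts n \<Longrightarrow> vertex_orbit n x = {x, rot n x, rot n (rot n x)}"
  unfolding vertex_orbit_def by (intro orbit_period_3 rot_rot_rot)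

lemma edge_orbit_eq:
  "(x, y) \<in> A_arcs n \<Longrightarrow> edge_orbit n (x, y) =
    {(x, y), (rot n x, rot n y), (rot n (rot n x), rot n (rot n y))}"
  unfolding edge_orbit_def
  by (subst orbit_period_3) (auto simp: rot_rot_rot dest!: A_arcs_verts)

lemma vertex_orbit_rot: "x \<in> A_verts n \<Longrightarrow> vertex_orbit n (rot n x) = vertex_orbit n x"
  by (auto simp: vertex_orbit_eq rot_in_verts rot_rot_rot)

lemma edge_orbit_rot:
  "(x, y) \<in> A_arcs n \<Longrightarrow> edge_orbit n (rot n x, rot n y) = edge_orbit n (x, y)"
  by (auto simp: edge_orbit_eq rot_in_arcs rot_rot_rot dest: A_arcs_verts)

lemma tail_edge_orbit: "(x, y) \<in> A_arcs n \<Longrightarrow> fst ` edge_orbit n (x, y) = vertex_orbit n x"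
  by (auto simp: edge_orbit_eq vertex_orbit_eq dest: A_arcs_verts)

lemma head_edge_orbit: "(x, y) \<in> A_arcs n \<Longrightarrow> snd ` edge_orbit n (x, y) = vertex_orbit n y"
  by (auto simp: edge_orbit_eq vertex_orbit_eq dest: A_arcs_verts)

lemma colour_less: "colour x < 3"
  by (cases x) (simp add: colour.simps)

lemma colours_along_rotation:
  assumes "n mod 3 \<noteq> 0" "x \<in> A_verts n"
  shows "colour (rot n x) \<noteq> colour x \<and> colour (rot n (rot n x)) \<noteq> colour x \<and>
    colour (rot n (rot n x)) \<noteq> colour (rot n x)"
proof -
  define d where "d = n mod 3"
  have "d = 1 \<or> d = 2" using assms(1) unfolding d_def by auto
  moreover have "colour x = 0 \<or> colour x = 1 \<or> colour x = 2" using colour_less[of x] by auto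
  moreover have "colour (rot n x) = (colour x + d) mod 3"
    "colour (rot n (rot n x)) = (colour (rot n x) + d) mod 3"
    using assms(2) by (simp_all add: colour_rot rot_in_verts d_def mod_add_right_eq)
  ultimately show ?thesis by auto
qed

lemma rotation_of_colour:
  assumes "n mod 3 \<noteq> 0" "x \<in> A_verts n" "c < 3"
  shows "c \<in> {colour x, colour (rot n x), colour (rot n (rot n x))}"
proof -
  define p q r where "p = colour x" "q = colour (rot n x)" "r = colour (rot n (rot n x))"
  then have "p < 3" "q < 3" "r < 3" and ne: "p \<noteq> q" "p \<noteq> r" "q \<noteq> r"
    using colour_less colours_along_rotation[OF assms(1,2)] by auto
  then have "p \<in> {0, 1, 2}" "q \<in> {0, 1, 2}" "r \<in> {0, 1, 2}" "c \<in> {0, 1, 2}"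
    using assms(3) by auto
  then show ?thesis using ne unfolding p_q_r_def(1-3)[symmetric] by auto
qed

lemma same_orbit_same_colour:
  assumes "n mod 3 \<noteq> 0" "x \<in> A_verts n" "y \<in> A_verts n"
    and "vertex_orbit n x = vertex_orbit n y" "colour x = colour y"
  shows "x = y"
proof -
  have "y \<in> {x, rot n x, rot n (rot n x)}" using assms(2-4) by (auto simp: vertex_orbit_eq)
  then show ?thesis using assms(5) colours_along_rotation[OF assms(1,2)] by auto
qed

section \<open>Cells of the triangle\<close>

text \<open>
  In the three coordinates \<open>a + 1\<close>, \<open>b + 1\<close> and \<open>a + b + 2\<close> of the vertices \<open>(a, b)\<close> of a triangle,
  each coordinate takes two consecutive values, and the cell value, for upward and downward triangles
  alike, is made of the quantum integers of all these values. Written through minima and maxima, it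
  is visibly invariant under rotating the triangle, and the reflection \<open>m \<mapsto> n - m\<close> of quantum
  integers makes it invariant under the \<open>Z/3\<close>-action.
\<close>

definition extremes :: "nat \<Rightarrow> nat \<Rightarrow> nat \<Rightarrow> nat \<Rightarrow> real" where
  "extremes n p r s = qint n (min p (min r s)) * qint n (max p (max r s))"

fun A_value :: "nat \<Rightarrow> vertex \<Rightarrow> vertex \<Rightarrow> vertex \<Rightarrow> real" where
  "A_value n (a, b) (c, d) (e, f) =
     sqrt (extremes n (a + 1) (c + 1) (e + 1) * extremes n (b + 1) (d + 1) (f + 1) *
           extremes n (a + b + 2) (c + d + 2) (e + f + 2)) / qint n 2"

lemma extremes_rotate: "extremes n p r s = extremes n r s p"
  by (simp add: extremes_def min.commute min.left_commute max.commute max.left_commute)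

lemma A_value_rotate: "A_value n x y z = A_value n y z x"
proof -
  obtain a b c d e f where "x = (a, b)" "y = (c, d)" "z = (e, f)" by (metis surj_pair)
  then show ?thesis
    using extremes_rotate[of n "a + 1" "c + 1" "e + 1"] extremes_rotate[of n "b + 1" "d + 1" "f + 1"]
      extremes_rotate[of n "a + b + 2" "c + d + 2" "e + f + 2"] by simp
qed

lemma extremes_reflect:
  assumes "p \<le> n" "r \<le> n" "s \<le> n" "0 < n"
  shows "extremes n (n - p) (n - r) (n - s) = extremes n p r s"
proof -
  have "min (n - p) (min (n - r) (n - s)) = n - max p (max r s)"
    "max (n - p) (max (n - r) (n - s)) = n - min p (min r s)"
    using assms by (auto simp: min_def max_def)
  moreover have "min p (min r s) \<le> n" "max p (max r s) \<le> n" using assms by auto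
  ultimately show ?thesis using assms(4) by (simp add: extremes_def qint_reflect)
qed

lemma A_value_rot:
  assumes "x \<in> A_verts n" "y \<in> A_verts n" "z \<in> A_verts n"
  shows "A_value n (rot n x) (rot n y) (rot n z) = A_value n x y z"
proof -
  obtain a b c d e f where xyz: "x = (a, b)" "y = (c, d)" "z = (e, f)" by (metis surj_pair)
  have rot: "p + q + 3 \<le> n \<Longrightarrow> n - 3 - p - q + 1 = n - (p + q + 2)"
    "p + q + 3 \<le> n \<Longrightarrow> n - 3 - p - q + p + 2 = n - (q + 1)" for p q :: nat by auto
  have le: "a + b + 3 \<le> n" "c + d + 3 \<le> n" "e + f + 3 \<le> n"
    using assms by (auto simp: xyz A_verts_def)
  then have le': "a + b + 2 \<le> n" "c + d + 2 \<le> n" "e + f + 2 \<le> n" "b + 1 \<le> n" "d + 1 \<le> n" "f + 1 \<le> n" "0 < n"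
    by auto
  show ?thesis
    unfolding xyz rot.simps A_value.simps using le le'
    by (simp only: rot extremes_reflect mult_ac)
qed

lemma A_eigenvector_rot: "x \<in> A_verts n \<Longrightarrow> A_eigenvector n (rot n x) = A_eigenvector n x"
proof -
  assume x: "x \<in> A_verts n"
  obtain a b where ab: "x = (a, b)" by (cases x)
  have le: "a + b + 3 \<le> n" using x by (simp add: ab A_verts_def)
  then have *: "n - 3 - a - b + 1 = n - (a + b + 2)" "n - 3 - a - b + a + 2 = n - (b + 1)" by auto
  show ?thesis unfolding ab rot.simps A_eigenvector.simps * using le
    by (simp add: qint_reflect)
qed

lemma A_value_up: "A_value n (k, m) (k + 1, m) (k, m + 1) = W_up n k m"
  by (simp add: W_up_def extremes_def min_def max_def mult_ac numeral_2_eq_2 numeral_3_eq_3)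

lemma A_value_down: "A_value n (k + 1, m) (k, m + 1) (k + 1, m + 1) = W_down n k m"
  by (simp add: W_down_def extremes_def min_def max_def mult_ac numeral_2_eq_2 numeral_3_eq_3 eval_nat_numeral)

lemma A_cell_imp_A_value: "A_cell n a b c w \<Longrightarrow> w = A_value n (fst a) (fst b) (fst c)"
proof (induction rule: A_cell.induct)
  case (up k m)
  show ?case using A_value_up[of n k m] by simp
next
  case (down k m)
  show ?case using A_value_down[of n k m] by simp
next
  case (rotate a b c w)
  then show ?case using A_value_rotate by metis
qed

lemma third_vertex_iff:
  assumes "a + b + 4 \<le> n"
  shows "((a + 1, b), z) \<in> A_arcs n \<and> (z, (a, b)) \<in> A_arcs n \<longleftrightarrow>
    z = (a, b + 1) \<or> (\<exists>b'. b = b' + 1 \<and> z = (a + 1, b'))"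
  using assms by (cases z) (auto simp: A_arcs_def A_verts_def)

lemma triangle_has_horizontal_arc:
  assumes "(x, y) \<in> A_arcs n" "(y, z) \<in> A_arcs n" "(z, x) \<in> A_arcs n"
  obtains a b where "a + b + 4 \<le> n" "x = (a, b) \<and> y = (a + 1, b) \<or> y = (a, b) \<and> z = (a + 1, b) \<or> z = (a, b) \<and> x = (a + 1, b)"
proof -
  obtain a b c d e f where xyz: "x = (a, b)" "y = (c, d)" "z = (e, f)" by (metis surj_pair)
  show ?thesis
    using assms that[of a b] that[of c d] that[of e f] unfolding xyz A_arcs_def A_verts_def by auto
qed

lemma A_triangle_iff:
  "triangle (A_graph n) (x, y) (y, z) (z, x) \<longleftrightarrow>
     (x, y) \<in> A_arcs n \<and> (y, z) \<in> A_arcs n \<and> (z, x) \<in> A_arcs n"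
  by (simp add: triangle_def A_graph_def)

lemma A_cell_horizontal:
  assumes "a + b + 4 \<le> n" "((a + 1, b), z) \<in> A_arcs n" "(z, (a, b)) \<in> A_arcs n"
  shows "\<exists>w. A_cell n ((a, b), (a + 1, b)) ((a + 1, b), z) (z, (a, b)) w"
proof -
  have "((a, b), (a + 1, b)) \<in> A_arcs n" using assms(1) by (auto simp: A_arcs_def A_verts_def)
  then have t: "triangle (A_graph n) ((a, b), (a + 1, b)) ((a + 1, b), z) (z, (a, b))"
    using assms(2,3) by (simp add: A_triangle_iff)
  consider "z = (a, b + 1)" | b' where "b = b' + 1" "z = (a + 1, b')"
    using third_vertex_iff[OF assms(1)] assms(2,3) by blast
  then show ?thesis
  proof cases
    case 1
    then show ?thesis using A_cell.up[of n a b] t by auto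
  next
    case 2
    then have "triangle (A_graph n) ((a + 1, b'), (a, b' + 1)) ((a, b' + 1), (a + 1, b' + 1)) ((a + 1, b' + 1), (a + 1, b'))"
      using t by (simp add: A_triangle_iff)
    from A_cell.rotate[OF A_cell.down[OF this]] show ?thesis using 2 by auto
  qed
qed

lemma A_cell_exists:
  assumes "(x, y) \<in> A_arcs n" "(y, z) \<in> A_arcs n" "(z, x) \<in> A_arcs n"
  shows "A_cell n (x, y) (y, z) (z, x) (A_value n x y z)"
proof -
  obtain a b where ab: "a + b + 4 \<le> n"
    "x = (a, b) \<and> y = (a + 1, b) \<or> y = (a, b) \<and> z = (a + 1, b) \<or> z = (a, b) \<and> x = (a + 1, b)"
    by (rule triangle_has_horizontal_arc[OF assms])
  have "\<exists>w. A_cell n (x, y) (y, z) (z, x) w"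
    using ab(2)
  proof (elim disjE conjE)
    assume "x = (a, b)" "y = (a + 1, b)"
    then show ?thesis using A_cell_horizontal[OF ab(1), of z] assms by simp
  next
    assume "y = (a, b)" "z = (a + 1, b)"
    then obtain w where "A_cell n (y, z) (z, x) (x, y) w"
      using A_cell_horizontal[OF ab(1), of x] assms by auto
    then show ?thesis using A_cell.rotate by blast
  next
    assume "z = (a, b)" "x = (a + 1, b)"
    then obtain w where "A_cell n (z, x) (x, y) (y, z) w"
      using A_cell_horizontal[OF ab(1), of y] assms by auto
    then show ?thesis using A_cell.rotate by blast
  qed
  then show ?thesis using A_cell_imp_A_value by fastforce
qed

lemma A_value_pos:
  assumes "x \<in> A_verts n" "y \<in> A_verts n" "z \<in> A_verts n"
  shows "A_value n x y z > 0"
proof -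
  obtain a b c d e f where xyz: "x = (a, b)" "y = (c, d)" "z = (e, f)" by (metis surj_pair)
  have le: "a + b + 3 \<le> n" "c + d + 3 \<le> n" "e + f + 3 \<le> n"
    using assms by (auto simp: xyz A_verts_def)
  then show ?thesis unfolding xyz A_value.simps extremes_def
    by (intro divide_pos_pos real_sqrt_gt_zero mult_pos_pos qint_pos) (auto simp: min_def max_def)
qed

lemma A_value_square:
  assumes "(a, b) \<in> A_verts n" "(c, d) \<in> A_verts n" "(e, f) \<in> A_verts n"
  shows "(A_value n (a, b) (c, d) (e, f))\<^sup>2 =
     extremes n (a + 1) (c + 1) (e + 1) * extremes n (b + 1) (d + 1) (f + 1) *
     extremes n (a + b + 2) (c + d + 2) (e + f + 2) / (qint n 2)\<^sup>2"
proof -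
  have "extremes n (a + 1) (c + 1) (e + 1) * extremes n (b + 1) (d + 1) (f + 1) *
     extremes n (a + b + 2) (c + d + 2) (e + f + 2) \<ge> 0"
    unfolding extremes_def using assms
    by (intro mult_nonneg_nonneg qint_nonneg) (auto simp: A_verts_def)
  then show ?thesis by (simp add: power_divide)
qed

declare A_eigenvector.simps [simp del] A_value.simps [simp del]

lemma value_up_square:
  assumes "a + b + 4 \<le> n"
  shows "(A_value n (a, b) (a + 1, b) (a, b + 1))\<^sup>2 =
    qint n (a + 1) * qint n (a + 2) * qint n (b + 1) * qint n (b + 2) *
    qint n (a + b + 2) * qint n (a + b + 3) / (qint n 2)\<^sup>2"
  using assms by (subst A_value_square)
    (auto simp: A_verts_def extremes_def min_def max_def numeral_2_eq_2 numeral_3_eq_3)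

lemma value_down_square:
  assumes "a + b + 5 \<le> n"
  shows "(A_value n (a, b + 1) (a + 1, b + 1) (a + 1, b))\<^sup>2 =
    qint n (a + 1) * qint n (a + 2) * qint n (b + 1) * qint n (b + 2) *
    qint n (a + b + 3) * qint n (a + b + 4) / (qint n 2)\<^sup>2"
  using assms by (subst A_value_square)
    (auto simp: A_verts_def extremes_def min_def max_def eval_nat_numeral)

lemma sum_third_vertices:
  fixes f :: "vertex \<Rightarrow> real"
  assumes "a + b + 4 \<le> n"
  shows "(\<Sum>z | ((a + 1, b), z) \<in> A_arcs n \<and> (z, (a, b)) \<in> A_arcs n. f z) =
    f (a, b + 1) + (if b = 0 then 0 else f (a + 1, b - 1))"
proof -
  have "{z. ((a + 1, b), z) \<in> A_arcs n \<and> (z, (a, b)) \<in> A_arcs n} =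
      insert (a, b + 1) (if b = 0 then {} else {(a + 1, b - 1)})"
    using third_vertex_iff[OF assms] by (cases b) auto
  then show ?thesis by simp
qed

text \<open>
  By the \<open>Z/3\<close>-symmetry it is enough to check the cell equations for a horizontal arc
  \<open>(a, b) \<rightarrow> (a + 1, b)\<close>, which lies on the two triangles with third vertex \<open>(a, b + 1)\<close> and
  \<open>(a + 1, b - 1)\<close>. The second one is missing on the boundary \<open>b = 0\<close>, where the formula for its
  contribution contains the factor \<open>qint n 0 = 0\<close>.
\<close>

context
  fixes n a b :: nat
  assumes horizontal: "a + b + 4 \<le> n"
begin

lemma horizontal_type_I:
  "(\<Sum>z | ((a + 1, b), z) \<in> A_arcs n \<and> (z, (a, b)) \<in> A_arcs n. (A_value n (a, b) (a + 1, b) z)\<^sup>2)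
     = qint n 2 * A_eigenvector n (a, b) * A_eigenvector n (a + 1, b)"
proof -
  have n2: "qint n 2 > 0" "n \<ge> 2" using horizontal by (auto intro: qint_pos)
  have "(if b = 0 then 0 else (A_value n (a, b) (a + 1, b) (a + 1, b - 1))\<^sup>2) =
    qint n (a + 1) * qint n (a + 2) * qint n b * qint n (b + 1) *
    qint n (a + b + 2) * qint n (a + b + 3) / (qint n 2)\<^sup>2"
  proof (cases b)
    case (Suc b')
    then show ?thesis using value_down_square[of a b' n] horizontal by (simp add: eval_nat_numeral)
  qed simp
  then have "(\<Sum>z | ((a + 1, b), z) \<in> A_arcs n \<and> (z, (a, b)) \<in> A_arcs n. (A_value n (a, b) (a + 1, b) z)\<^sup>2)
    = qint n (a + 1) * qint n (a + 2) * qint n (b + 1) * qint n (a + b + 2) * qint n (a + b + 3) *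
       (qint n b + qint n (b + 2)) / (qint n 2)\<^sup>2"
    unfolding sum_third_vertices[OF horizontal] value_up_square[OF horizontal]
    by (simp only: distrib_left add_divide_distrib mult_ac)
  also have "qint n b + qint n (b + 2) = qint n 2 * qint n (b + 1)"
    using qint_2_mult[OF n2(2)] by simp
  finally show ?thesis using n2(1) by (simp add: A_eigenvector.simps power2_eq_square eval_nat_numeral field_simps)
qed

text \<open>
  This is the equation of type II for four equal arcs. In the abbreviations of the proof, and after
  cancelling common factors, it reads
  \<open>A2 * (B2 * S) + A1 * (B0 * S1) = A2 * (B1 * S1) + A1 * (B1 * S)\<close>, which holds because both
  differences \<open>B2 * S - B1 * S1\<close> and \<open>B1 * S - B0 * S1\<close> are again quantum integers.
\<close>

lemma horizontal_type_II_parallel: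
  "(\<Sum>z | ((a + 1, b), z) \<in> A_arcs n \<and> (z, (a, b)) \<in> A_arcs n.
      ((A_value n (a, b) (a + 1, b) z)\<^sup>2)\<^sup>2 / A_eigenvector n z)
     = A_eigenvector n (a, b) * A_eigenvector n (a + 1, b) *
        (A_eigenvector n (a, b) + A_eigenvector n (a + 1, b))"
proof -
  define t A1 A2 B0 B1 B2 S S1 where defs: "t = qint n 2" "A1 = qint n (a + 1)" "A2 = qint n (a + 2)"
    "B0 = qint n b" "B1 = qint n (b + 1)" "B2 = qint n (b + 2)"
    "S = qint n (a + b + 2)" "S1 = qint n (a + b + 3)"
  have pos: "t > 0" "A1 > 0" "A2 > 0" "B1 > 0" "S > 0" "S1 > 0"
    using horizontal by (auto simp: defs intro!: qint_pos)
  have n2: "n \<ge> 2" using horizontal by simp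
  have cross: "B2 * S = B1 * S1 + A1" "B1 * S = B0 * S1 + A2"
    using qint_cross[OF n2, of "b + 1" "a + 1"] qint_cross[OF n2, of b "a + 2"]
    by (simp_all add: defs add_ac eval_nat_numeral)
  have phi: "A_eigenvector n (a, b) = A1 * B1 * S / t" "A_eigenvector n (a + 1, b) = A2 * B1 * S1 / t"
    by (simp_all add: defs A_eigenvector.simps eval_nat_numeral)
  have up: "((A_value n (a, b) (a + 1, b) (a, b + 1))\<^sup>2)\<^sup>2 / A_eigenvector n (a, b + 1) =
    A1 * A2\<^sup>2 * B1\<^sup>2 * (B2 * S) * S * S1 / t ^ 3"
  proof -
    have "A_eigenvector n (a, b + 1) = A1 * B2 * S1 / t" by (simp add: defs A_eigenvector.simps eval_nat_numeral)
    moreover have "B2 > 0" using horizontal by (auto simp: defs intro!: qint_pos)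
    ultimately show ?thesis
      unfolding value_up_square[OF horizontal] defs(1-8)[symmetric]
      using pos by (simp add: field_simps power2_eq_square power3_eq_cube)
  qed
  have down: "(if b = 0 then 0 else
      ((A_value n (a, b) (a + 1, b) (a + 1, b - 1))\<^sup>2)\<^sup>2 / A_eigenvector n (a + 1, b - 1)) =
    A1\<^sup>2 * A2 * (B0 * S1) * B1\<^sup>2 * S * S1 / t ^ 3"
  proof (cases b)
    case (Suc b')
    have e: "A_eigenvector n (a + 1, b') = A2 * B0 * S / t" using Suc by (simp add: defs A_eigenvector.simps eval_nat_numeral)
    have "B0 > 0" using horizontal Suc by (auto simp: defs intro!: qint_pos)
    have v: "(A_value n (a, b) (a + 1, b) (a + 1, b'))\<^sup>2 = A1 * A2 * B0 * B1 * S * S1 / t\<^sup>2"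
      using value_down_square[of a b' n] horizontal Suc by (simp add: defs eval_nat_numeral)
    have "b \<noteq> 0" "b - 1 = b'" using Suc by simp_all
    then show ?thesis
      using pos \<open>B0 > 0\<close> by (simp only: e v if_False) (simp add: field_simps power2_eq_square power3_eq_cube)
  qed (simp add: defs)
  have "A2 * (B2 * S) + A1 * (B0 * S1) = A2 * (B1 * S1) + A1 * (B1 * S)"
    unfolding cross by (simp add: algebra_simps)
  then have "A1 * A2 * B1\<^sup>2 * S * S1 * (A2 * (B2 * S) + A1 * (B0 * S1)) / t ^ 3 =
    A1 * A2 * B1\<^sup>2 * S * S1 * (A2 * (B1 * S1) + A1 * (B1 * S)) / t ^ 3" by simp
  then show ?thesis
    unfolding sum_third_vertices[OF horizontal] up down phi
    by (simp add: power2_eq_square power3_eq_cube add_divide_distrib algebra_simps)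
qed

text \<open>
  If only the tails or only the heads of the arcs in an equation of type II agree, the sum has a
  single term: two different arcs into (or out of) a vertex lie on triangles with exactly one common
  third vertex. The two sides are then equal factor by factor.
\<close>

lemma horizontal_type_II_common_head_below:
  assumes "b = b' + 1"
  shows "(A_value n (a, b) (a + 1, b) (a + 1, b'))\<^sup>2 * (A_value n (a + 2, b') (a + 1, b) (a + 1, b'))\<^sup>2 /
      A_eigenvector n (a + 1, b')
    = A_eigenvector n (a, b) * A_eigenvector n (a + 1, b) * A_eigenvector n (a + 2, b')"
proof -
  have v: "(A_value n (a, b) (a + 1, b) (a + 1, b'))\<^sup>2 =
      qint n (a + 1) * qint n (a + 2) * qint n (b' + 1) * qint n (b' + 2) *
      qint n (a + b' + 3) * qint n (a + b' + 4) / (qint n 2)\<^sup>2"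
    using value_down_square[of a b' n] assms horizontal by simp
  have w: "(A_value n (a + 2, b') (a + 1, b) (a + 1, b'))\<^sup>2 =
      qint n (a + 2) * qint n (a + 3) * qint n (b' + 1) * qint n (b' + 2) *
      qint n (a + b' + 3) * qint n (a + b' + 4) / (qint n 2)\<^sup>2"
    using value_up_square[of "a + 1" b' n] A_value_rotate[of n "(a + 1, b')" "(a + 2, b')" "(a + 1, b)"]
      assms horizontal by (simp add: eval_nat_numeral)
  have "qint n 2 > 0" "qint n (a + 2) > 0" "qint n (b' + 1) > 0" "qint n (a + b' + 3) > 0"
    using horizontal assms by (auto intro!: qint_pos)
  then show ?thesis unfolding v w
    using assms by (simp add: A_eigenvector.simps eval_nat_numeral field_simps power2_eq_square)
qed

lemma horizontal_type_II_common_head_above: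
  assumes "a + b + 5 \<le> n"
  shows "(A_value n (a, b) (a + 1, b) (a, b + 1))\<^sup>2 * (A_value n (a + 1, b + 1) (a + 1, b) (a, b + 1))\<^sup>2 /
      A_eigenvector n (a, b + 1)
    = A_eigenvector n (a, b) * A_eigenvector n (a + 1, b) * A_eigenvector n (a + 1, b + 1)"
proof -
  note v = value_up_square[OF horizontal]
  have w: "(A_value n (a + 1, b + 1) (a + 1, b) (a, b + 1))\<^sup>2 =
      qint n (a + 1) * qint n (a + 2) * qint n (b + 1) * qint n (b + 2) *
      qint n (a + b + 3) * qint n (a + b + 4) / (qint n 2)\<^sup>2"
    using value_down_square[OF assms] by (subst (asm) A_value_rotate)
  have "qint n 2 > 0" "qint n (a + 1) > 0" "qint n (b + 2) > 0" "qint n (a + b + 3) > 0"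
    using assms by (auto intro!: qint_pos)
  then show ?thesis unfolding v w
    by (simp add: A_eigenvector.simps eval_nat_numeral field_simps power2_eq_square)
qed

lemma horizontal_type_II_common_tail_above:
  assumes "a = a' + 1"
  shows "(A_value n (a, b) (a + 1, b) (a, b + 1))\<^sup>2 * (A_value n (a, b) (a', b + 1) (a, b + 1))\<^sup>2 /
      A_eigenvector n (a, b + 1)
    = A_eigenvector n (a, b) * A_eigenvector n (a + 1, b) * A_eigenvector n (a', b + 1)"
proof -
  have le: "a' + b + 5 \<le> n" using horizontal assms by simp
  note v = value_up_square[OF horizontal]
  have w: "(A_value n (a, b) (a', b + 1) (a, b + 1))\<^sup>2 =
      qint n (a' + 1) * qint n (a' + 2) * qint n (b + 1) * qint n (b + 2) *
      qint n (a' + b + 3) * qint n (a' + b + 4) / (qint n 2)\<^sup>2"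
    unfolding assms A_value_rotate[of n "(a' + 1, b)"] by (rule value_down_square[OF le])
  have "qint n 2 > 0" "qint n (a' + 2) > 0" "qint n (b + 2) > 0" "qint n (a' + b + 4) > 0"
    using horizontal assms by (auto intro!: qint_pos)
  then show ?thesis unfolding v w
    by (simp add: assms A_eigenvector.simps eval_nat_numeral field_simps power2_eq_square)
qed

lemma horizontal_type_II_common_tail_below:
  assumes "b = b' + 1"
  shows "(A_value n (a, b) (a + 1, b) (a + 1, b'))\<^sup>2 * (A_value n (a, b) (a, b') (a + 1, b'))\<^sup>2 /
      A_eigenvector n (a + 1, b')
    = A_eigenvector n (a, b) * A_eigenvector n (a + 1, b) * A_eigenvector n (a, b')"
proof -
  have le: "a + b' + 4 \<le> n" using horizontal assms by simp
  have v: "(A_value n (a, b) (a + 1, b) (a + 1, b'))\<^sup>2 =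
      qint n (a + 1) * qint n (a + 2) * qint n (b' + 1) * qint n (b' + 2) *
      qint n (a + b' + 3) * qint n (a + b' + 4) / (qint n 2)\<^sup>2"
    using value_down_square[of a b' n] assms horizontal by simp
  have w: "(A_value n (a, b) (a, b') (a + 1, b'))\<^sup>2 =
      qint n (a + 1) * qint n (a + 2) * qint n (b' + 1) * qint n (b' + 2) *
      qint n (a + b' + 2) * qint n (a + b' + 3) / (qint n 2)\<^sup>2"
    unfolding assms A_value_rotate[of n "(a, b' + 1)"] by (rule value_up_square[OF le])
  have "qint n 2 > 0" "qint n (a + 2) > 0" "qint n (b' + 1) > 0" "qint n (a + b' + 3) > 0"
    using horizontal assms by (auto intro!: qint_pos)
  then show ?thesis unfolding v w
    using assms by (simp add: A_eigenvector.simps eval_nat_numeral field_simps power2_eq_square)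
qed

text \<open>
  Every 4-cycle of alternating orientation is degenerate, as the difference of two different arc
  directions determines both directions.
\<close>

lemma horizontal_square_cases:
  assumes "(x3, (a + 1, b)) \<in> A_arcs n" "(x3, x4) \<in> A_arcs n" "((a, b), x4) \<in> A_arcs n"
  obtains "x3 = (a, b)" "x4 = (a + 1, b)"
    | b' where "x4 = (a + 1, b)" "b = b' + 1" "x3 = (a + 2, b')"
    | "x4 = (a + 1, b)" "a + b + 5 \<le> n" "x3 = (a + 1, b + 1)"
    | a' where "x3 = (a, b)" "a = a' + 1" "x4 = (a', b + 1)"
    | b' where "x3 = (a, b)" "b = b' + 1" "x4 = (a, b')"
proof -
  obtain c d e f where xs: "x3 = (c, d)" "x4 = (e, f)" by (metis surj_pair)
  show ?thesis
    using assms that unfolding xs A_arcs_def A_verts_def by auto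
qed

lemma horizontal_type_II:
  assumes "(x3, (a + 1, b)) \<in> A_arcs n" "(x3, x4) \<in> A_arcs n" "((a, b), x4) \<in> A_arcs n"
  shows "(\<Sum>z | ((a + 1, b), z) \<in> A_arcs n \<and> (z, (a, b)) \<in> A_arcs n \<and> (z, x3) \<in> A_arcs n \<and> (x4, z) \<in> A_arcs n.
      A_value n (a, b) (a + 1, b) z * A_value n x3 (a + 1, b) z *
      A_value n x3 x4 z * A_value n (a, b) x4 z / A_eigenvector n z)
    = of_bool ((a + 1, b) = x4) * (A_eigenvector n (a, b) * A_eigenvector n (a + 1, b) * A_eigenvector n x3)
    + of_bool ((a, b) = x3) * (A_eigenvector n (a, b) * A_eigenvector n (a + 1, b) * A_eigenvector n x4)"
    (is "(\<Sum>z\<in>?Z. ?f z) = ?rhs")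
proof -
  have Z: "?Z = {z. (z = (a, b + 1) \<or> (\<exists>b'. b = b' + 1 \<and> z = (a + 1, b'))) \<and>
      (z, x3) \<in> A_arcs n \<and> (x4, z) \<in> A_arcs n}"
    using third_vertex_iff[OF horizontal] by auto
  show ?thesis
  proof (rule horizontal_square_cases[OF assms])
    assume c: "x3 = (a, b)" "x4 = (a + 1, b)"
    then have "?Z = {z. ((a + 1, b), z) \<in> A_arcs n \<and> (z, (a, b)) \<in> A_arcs n}" by auto
    then show ?thesis
      using horizontal_type_II_parallel c
      by (simp add: power2_eq_square mult_ac distrib_left)
  next
    fix b' assume c: "x4 = (a + 1, b)" "b = b' + 1" "x3 = (a + 2, b')"
    have "?Z = {(a + 1, b')}"
      unfolding Z using c horizontal by (auto simp: A_arcs_def A_verts_def)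
    then show ?thesis
      using horizontal_type_II_common_head_below[OF c(2)] c by (simp add: power2_eq_square mult_ac)
  next
    assume c: "x4 = (a + 1, b)" "a + b + 5 \<le> n" "x3 = (a + 1, b + 1)"
    have "?Z = {(a, b + 1)}"
      unfolding Z using c horizontal by (auto simp: A_arcs_def A_verts_def)
    then show ?thesis
      using horizontal_type_II_common_head_above[OF c(2)] c by (simp add: power2_eq_square mult_ac)
  next
    fix a' assume c: "x3 = (a, b)" "a = a' + 1" "x4 = (a', b + 1)"
    have "?Z = {(a, b + 1)}"
      unfolding Z using c horizontal by (auto simp: A_arcs_def A_verts_def)
    then show ?thesis
      using horizontal_type_II_common_tail_above[OF c(2)] c by (simp add: power2_eq_square mult_ac)
  next
    fix b' assume c: "x3 = (a, b)" "b = b' + 1" "x4 = (a, b')"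
    have "?Z = {(a + 1, b')}"
      unfolding Z using c horizontal by (auto simp: A_arcs_def A_verts_def)
    then show ?thesis
      using horizontal_type_II_common_tail_below[OF c(2)] c by (simp add: power2_eq_square mult_ac)
  qed
qed

end

section \<open>Passing to the orbifold\<close>

lemma D_graph_simps [simp]:
  "verts (D_graph n) = vertex_orbit n ` A_verts n"
  "arcs (D_graph n) = edge_orbit n ` A_arcs n"
  "tail (D_graph n) = (`) fst"
  "head (D_graph n) = (`) snd"
  by (simp_all add: D_graph_def)

text \<open>The three arcs of an orbit have the three different directions.\<close>

lemma horizontal_representative:
  assumes "\<alpha> \<in> arcs (D_graph n)"
  obtains a b where "a + b + 4 \<le> n" "\<alpha> = edge_orbit n ((a, b), (a + 1, b))"
proof -
  obtain x y where xy: "(x, y) \<in> A_arcs n" "\<alpha> = edge_orbit n (x, y)" using assms by auto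
  have rot2: "(rot n (rot n x), rot n (rot n y)) \<in> A_arcs n"
    "edge_orbit n (rot n (rot n x), rot n (rot n y)) = \<alpha>"
    using xy by (auto simp: rot_in_arcs edge_orbit_rot)
  obtain a b c d where ab: "x = (a, b)" "y = (c, d)" by (metis surj_pair)
  have le: "a + b + 3 \<le> n" "c + d + 3 \<le> n" using xy by (auto simp: ab A_arcs_def A_verts_def)
  from xy(1) consider "c = a + 1" "d = b" | "c + 1 = a" "d = b + 1" | "c = a" "d + 1 = b"
    by (auto simp: ab A_arcs_def)
  then show thesis
  proof cases
    case 1
    then show thesis using that[of a b] le xy(2) by (simp add: ab)
  next
    case 2
    have "rot n (rot n x) = (b, n - 3 - a - b)" "rot n (rot n y) = (b + 1, n - 3 - a - b)"
      using le 2 by (auto simp: ab rot.simps)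
    then show thesis using that[of b "n - 3 - a - b"] le 2 rot2(2) by simp
  next
    case 3
    have "rot n x = (n - 3 - a - b, a)" "rot n y = (n - 3 - a - b + 1, a)"
      using le 3 by (auto simp: ab rot.simps)
    then show thesis using that[of "n - 3 - a - b" a] le 3 xy edge_orbit_rot[of x y n] by simp
  qed
qed

lemma colour_cycle: "((((colour x + 1) mod 3) + 1) mod 3 + 1) mod 3 = colour x"
proof -
  have "colour x = 0 \<or> colour x = 1 \<or> colour x = 2" using colour_less[of x] by auto
  then show ?thesis by auto
qed

lemma horizontal_arc: "a + b + 4 \<le> n \<Longrightarrow> ((a, b), (a + 1, b)) \<in> A_arcs n"
  by (auto simp: A_arcs_def A_verts_def)

lemma A_cell_triangle:
  "A_cell n a b c w \<Longrightarrow> \<exists>x y z. a = (x, y) \<and> b = (y, z) \<and> c = (z, x) \<and>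
     (x, y) \<in> A_arcs n \<and> (y, z) \<in> A_arcs n \<and> (z, x) \<in> A_arcs n"
  by (induction rule: A_cell.induct) (auto simp: A_triangle_iff)

lemma D_eigenvector_orbit:
  assumes "x \<in> A_verts n"
  shows "D_eigenvector n (vertex_orbit n x) = A_eigenvector n x"
proof -
  have "(SOME z. z \<in> vertex_orbit n x) \<in> vertex_orbit n x"
    by (rule someI[of _ x]) (simp add: vertex_orbit_eq assms)
  then show ?thesis
    using assms by (auto simp: D_eigenvector_def vertex_orbit_eq A_eigenvector_rot rot_in_verts)
qed

context
  fixes n :: nat
  assumes n3: "n mod 3 \<noteq> 0"
begin

lemma lift_vertex:
  assumes "k \<in> verts (D_graph n)" "c < 3"
  obtains z where "z \<in> A_verts n" "vertex_orbit n z = k" "colour z = c"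
proof -
  obtain x where x: "x \<in> A_verts n" "k = vertex_orbit n x" using assms(1) by auto
  have "c \<in> {colour x, colour (rot n x), colour (rot n (rot n x))}"
    by (rule rotation_of_colour[OF n3 x(1) assms(2)])
  then show thesis
    using that[of x] that[of "rot n x"] that[of "rot n (rot n x)"] x
    by (auto simp: rot_in_verts vertex_orbit_rot)
qed

lemma lift_arc:
  assumes "\<alpha> \<in> arcs (D_graph n)" "c < 3"
  obtains x y where "(x, y) \<in> A_arcs n" "edge_orbit n (x, y) = \<alpha>" "colour x = c"
proof -
  obtain x y where xy: "(x, y) \<in> A_arcs n" "\<alpha> = edge_orbit n (x, y)" using assms(1) by auto
  have "c \<in> {colour x, colour (rot n x), colour (rot n (rot n x))}"
    using rotation_of_colour[OF n3 _ assms(2), of x] A_arcs_verts[OF xy(1)] by blast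
  then show thesis
    using that[OF xy(1)] that[OF rot_in_arcs, OF xy(1)] that[OF rot_in_arcs[OF rot_in_arcs], OF xy(1)] xy
    by (auto simp: rot_in_arcs edge_orbit_rot)
qed

text \<open>
  Prescribing colours removes all ambiguity: the quotient graph has at most one arc between two
  vertices, and whether there is one can be decided on the lifts of suitable colours. Since closed
  paths of length 3 and the 4-cycles in the equations of type II respect the colours, all these
  configurations lift to the triangle graph.
\<close>

lemma arcs_between_orbits:
  assumes "x \<in> A_verts n" "y \<in> A_verts n" "colour y = (colour x + 1) mod 3"
  shows "arcs_between (D_graph n) (vertex_orbit n x) (vertex_orbit n y) =
    (if (x, y) \<in> A_arcs n then {edge_orbit n (x, y)} else {})"
proof -
  have "\<alpha> = edge_orbit n (x, y) \<and> (x, y) \<in> A_arcs n"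
    if \<alpha>: "\<alpha> \<in> arcs_between (D_graph n) (vertex_orbit n x) (vertex_orbit n y)" for \<alpha>
  proof -
    have "\<alpha> \<in> arcs (D_graph n)" using \<alpha> by (simp add: arcs_between_def)
    then obtain x' y' where xy: "(x', y') \<in> A_arcs n" "edge_orbit n (x', y') = \<alpha>" "colour x' = colour x"
      using lift_arc colour_less by metis
    have "vertex_orbit n x' = vertex_orbit n x" "vertex_orbit n y' = vertex_orbit n y"
      using \<alpha> xy(2) tail_edge_orbit[OF xy(1)] head_edge_orbit[OF xy(1)]
      by (auto simp: arcs_between_def)
    moreover have "colour y' = colour y" using colour_arc[OF xy(1)] xy(3) assms(3) by simp
    moreover have "x' \<in> A_verts n" "y' \<in> A_verts n" using A_arcs_verts[OF xy(1)] by auto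
    ultimately have "x' = x" "y' = y"
      using assms(1,2) xy(3) by (auto intro: same_orbit_same_colour[OF n3])
    then show ?thesis using xy by auto
  qed
  moreover have "edge_orbit n (x, y) \<in> arcs_between (D_graph n) (vertex_orbit n x) (vertex_orbit n y)"
    if "(x, y) \<in> A_arcs n"
    using that tail_edge_orbit head_edge_orbit by (auto simp: arcs_between_def)
  ultimately show ?thesis by auto
qed

lemma sum_orbits:
  fixes g :: "vertex set \<Rightarrow> complex"
  assumes "c < 3"
  shows "(\<Sum>k\<in>verts (D_graph n). g k) = (\<Sum>z | z \<in> A_verts n \<and> colour z = c. g (vertex_orbit n z))"
proof -
  have "bij_betw (vertex_orbit n) {z \<in> A_verts n. colour z = c} (verts (D_graph n))"
    unfolding bij_betw_def
  proof
    show "inj_on (vertex_orbit n) {z \<in> A_verts n. colour z = c}"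
    proof (rule inj_onI, rule same_orbit_same_colour[OF n3])
    qed simp_all
    show "vertex_orbit n ` {z \<in> A_verts n. colour z = c} = verts (D_graph n)"
    proof
      show "verts (D_graph n) \<subseteq> vertex_orbit n ` {z \<in> A_verts n. colour z = c}"
      proof
        fix k assume "k \<in> verts (D_graph n)"
        from this assms obtain z where "z \<in> A_verts n" "vertex_orbit n z = k" "colour z = c"
          by (rule lift_vertex)
        then show "k \<in> vertex_orbit n ` {z \<in> A_verts n. colour z = c}" by blast
      qed
    qed auto
  qed
  from sum.reindex_bij_betw[OF this] show ?thesis by metis
qed

lemma triangle_with_same_arc_orbits:
  assumes t: "(x, y) \<in> A_arcs n" "(y, z) \<in> A_arcs n" "(z, x) \<in> A_arcs n"
    and t': "(x', y') \<in> A_arcs n" "(y', z') \<in> A_arcs n" "(z', x') \<in> A_arcs n"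
    and "vertex_orbit n x' = vertex_orbit n x" "vertex_orbit n y' = vertex_orbit n y"
      "vertex_orbit n z' = vertex_orbit n z" "colour x' = colour x"
  shows "x' = x \<and> y' = y \<and> z' = z"
proof -
  have y: "colour y' = colour y"
    using colour_arc[OF t(1)] colour_arc[OF t'(1)] assms(10) by simp
  have "colour z' = colour z"
    using colour_arc[OF t(2)] colour_arc[OF t'(2)] y by simp
  moreover have "x \<in> A_verts n" "y \<in> A_verts n" "z \<in> A_verts n"
    "x' \<in> A_verts n" "y' \<in> A_verts n" "z' \<in> A_verts n"
    using t t' A_arcs_verts by blast+
  ultimately show ?thesis
    using y assms(7-10) by (intro conjI same_orbit_same_colour[OF n3])
qed

text \<open>
  Two triangles over the same triangle of the quotient differ by a rotation; rotating one of them so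
  that one vertex gets the colour of the corresponding vertex of the other makes them equal.
\<close>

lemma D_cell_value_iff:
  assumes t: "(x, y) \<in> A_arcs n" "(y, z) \<in> A_arcs n" "(z, x) \<in> A_arcs n"
  shows "D_cell_value n (edge_orbit n (x, y)) (edge_orbit n (y, z)) (edge_orbit n (z, x)) w \<longleftrightarrow>
    w = A_value n x y z"
proof
  assume "w = A_value n x y z"
  then show "D_cell_value n (edge_orbit n (x, y)) (edge_orbit n (y, z)) (edge_orbit n (z, x)) w"
    using A_cell_exists[OF t] unfolding D_cell_value_def by blast
next
  assume "D_cell_value n (edge_orbit n (x, y)) (edge_orbit n (y, z)) (edge_orbit n (z, x)) w"
  then obtain a b c where cell: "A_cell n a b c w"
    and eq: "edge_orbit n (x, y) = edge_orbit n a" "edge_orbit n (y, z) = edge_orbit n b"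
      "edge_orbit n (z, x) = edge_orbit n c" unfolding D_cell_value_def by blast
  obtain x' y' z' where abc: "a = (x', y')" "b = (y', z')" "c = (z', x')"
    and t': "(x', y') \<in> A_arcs n" "(y', z') \<in> A_arcs n" "(z', x') \<in> A_arcs n"
    using A_cell_triangle[OF cell] by blast
  have orbits: "vertex_orbit n x' = vertex_orbit n x" "vertex_orbit n y' = vertex_orbit n y"
      "vertex_orbit n z' = vertex_orbit n z"
    using tail_edge_orbit[OF t(1)] tail_edge_orbit[OF t'(1)] tail_edge_orbit[OF t(2)]
      tail_edge_orbit[OF t'(2)] tail_edge_orbit[OF t(3)] tail_edge_orbit[OF t'(3)] eq abc by auto
  have w: "w = A_value n x' y' z'" using A_cell_imp_A_value[OF cell] by (simp add: abc)
  note v = A_arcs_verts[OF t(1)] A_arcs_verts[OF t(2)]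
  define r where "r = rot n"
  have r: "(r p, r q) \<in> A_arcs n" if "(p, q) \<in> A_arcs n" for p q using that by (simp add: r_def rot_in_arcs)
  have rv: "r p \<in> A_verts n" "vertex_orbit n (r p) = vertex_orbit n p" if "p \<in> A_verts n" for p
    using that by (simp_all add: r_def rot_in_verts vertex_orbit_rot)
  have "colour x' \<in> {colour x, colour (r x), colour (r (r x))}"
    using rotation_of_colour[OF n3, of x "colour x'"] v colour_less by (auto simp: r_def)
  then have "(x', y', z') \<in> {(x, y, z), (r x, r y, r z), (r (r x), r (r y), r (r z))}"
    using triangle_with_same_arc_orbits[OF t t' orbits]
      triangle_with_same_arc_orbits[OF r[OF t(1)] r[OF t(2)] r[OF t(3)] t']
      triangle_with_same_arc_orbits[OF r[OF r[OF t(1)]] r[OF r[OF t(2)]] r[OF r[OF t(3)]] t']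
      orbits v by (auto simp: rv)
  then show "w = A_value n x y z"
    using w v by (auto simp: r_def A_value_rot rot_in_verts)
qed

lemma D_cell_orbits:
  assumes "(x, y) \<in> A_arcs n" "(y, z) \<in> A_arcs n" "(z, x) \<in> A_arcs n"
  shows "D_cell n (edge_orbit n (x, y)) (edge_orbit n (y, z)) (edge_orbit n (z, x)) =
    complex_of_real (A_value n x y z)"
  by (simp add: D_cell_def D_cell_value_iff[OF assms])

lemma lift_triangle:
  assumes t: "triangle (D_graph n) (edge_orbit n (x, y)) \<beta> \<gamma>" and xy: "(x, y) \<in> A_arcs n"
  obtains z where "(y, z) \<in> A_arcs n" "(z, x) \<in> A_arcs n"
    "\<beta> = edge_orbit n (y, z)" "\<gamma> = edge_orbit n (z, x)"
proof -
  define c where "c = (colour y + 1) mod 3"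
  obtain p q where pq: "(p, q) \<in> A_arcs n" "\<beta> = edge_orbit n (p, q)"
    using t by (auto simp: triangle_def)
  have "snd ` \<beta> \<in> verts (D_graph n)"
    using head_edge_orbit[OF pq(1)] A_arcs_verts[OF pq(1)] pq(2) by simp
  then obtain z where z: "z \<in> A_verts n" "vertex_orbit n z = snd ` \<beta>" "colour z = c"
    by (rule lift_vertex[of _ c]) (auto simp: c_def)
  have "colour y = (colour x + 1) mod 3" by (rule colour_arc[OF xy])
  then have "colour x = (colour z + 1) mod 3"
    using z(3) colour_cycle[of x] by (simp only: c_def)
  then have "arcs_between (D_graph n) (vertex_orbit n z) (vertex_orbit n x) =
      (if (z, x) \<in> A_arcs n then {edge_orbit n (z, x)} else {})"
    using z A_arcs_verts[OF xy] by (intro arcs_between_orbits) auto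
  moreover have "arcs_between (D_graph n) (vertex_orbit n y) (vertex_orbit n z) =
      (if (y, z) \<in> A_arcs n then {edge_orbit n (y, z)} else {})"
    using z A_arcs_verts[OF xy] by (intro arcs_between_orbits) (auto simp: c_def)
  moreover have "\<beta> \<in> arcs_between (D_graph n) (vertex_orbit n y) (vertex_orbit n z)"
    "\<gamma> \<in> arcs_between (D_graph n) (vertex_orbit n z) (vertex_orbit n x)"
    using t z(2) tail_edge_orbit[OF xy] head_edge_orbit[OF xy]
    by (auto simp: triangle_def arcs_between_def)
  ultimately show thesis using that[of z] by (auto split: if_splits)
qed

lemma rotation_invariant_D_cell: "rotation_invariant (D_graph n) (D_cell n)"
  unfolding rotation_invariant_def
proof (intro allI impI)
  fix \<alpha> \<beta> \<gamma> assume t: "triangle (D_graph n) \<alpha> \<beta> \<gamma>"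
  then obtain x y where xy: "(x, y) \<in> A_arcs n" "\<alpha> = edge_orbit n (x, y)" by (auto simp: triangle_def)
  obtain z where z: "(y, z) \<in> A_arcs n" "(z, x) \<in> A_arcs n"
    "\<beta> = edge_orbit n (y, z)" "\<gamma> = edge_orbit n (z, x)"
    using lift_triangle[OF t[unfolded xy(2)] xy(1)] by blast
  then show "D_cell n \<alpha> \<beta> \<gamma> = D_cell n \<beta> \<gamma> \<alpha>"
    using D_cell_orbits[OF xy(1) z(1,2)] D_cell_orbits[OF z(1,2) xy(1)] xy(2) A_value_rotate[of n x y z]
    by simp
qed

text \<open>
  In both types of equations, the vertex \<open>k\<close> that is summed over is lifted to the colour \<open>c\<close> that
  completes those of the endpoints of a lifted horizontal arc. The equation then becomes the one for
  horizontal arcs of the triangle graph.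
\<close>

lemma type_I_D_cell: "type_I n (D_graph n) (D_eigenvector n) (D_cell n)"
  unfolding type_I_def
proof (intro ballI)
  fix i j \<alpha> \<alpha>'
  assume \<alpha>: "\<alpha> \<in> arcs_between (D_graph n) i j" and \<alpha>': "\<alpha>' \<in> arcs_between (D_graph n) i j"
  then have "\<alpha> \<in> arcs (D_graph n)" by (simp add: arcs_between_def)
  then obtain a b where ab: "a + b + 4 \<le> n" "\<alpha> = edge_orbit n ((a, b), (a + 1, b))"
    by (rule horizontal_representative)
  define x y where "x = (a, b)" "y = (a + 1, b)"
  have xy: "(x, y) \<in> A_arcs n" using horizontal_arc[OF ab(1)] by (simp add: x_y_def)
  note v = A_arcs_verts[OF xy]
  have \<alpha>_eq: "\<alpha> = edge_orbit n (x, y)" using ab(2) by (simp add: x_y_def)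
  have ij: "i = vertex_orbit n x" "j = vertex_orbit n y"
    using \<alpha> tail_edge_orbit[OF xy] head_edge_orbit[OF xy] \<alpha>_eq by (auto simp: arcs_between_def)
  have "\<alpha>' = \<alpha>"
    using \<alpha> \<alpha>' arcs_between_orbits[of x y] v colour_arc[OF xy] unfolding ij by (auto split: if_splits)
  define c where "c = (colour y + 1) mod 3"
  have cx: "colour x = (c + 1) mod 3"
    using colour_arc[OF xy] colour_cycle[of x] by (simp only: c_def)
  let ?Z = "{z. (y, z) \<in> A_arcs n \<and> (z, x) \<in> A_arcs n}"
  let ?C = "{z. z \<in> A_verts n \<and> colour z = c}"
  have C: "arcs_between (D_graph n) j (vertex_orbit n z) = (if (y, z) \<in> A_arcs n then {edge_orbit n (y, z)} else {})"
    "arcs_between (D_graph n) (vertex_orbit n z) i = (if (z, x) \<in> A_arcs n then {edge_orbit n (z, x)} else {})"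
    if "z \<in> ?C" for z
    unfolding ij using that v cx by (intro arcs_between_orbits; simp add: c_def)+
  have "z \<in> ?C" if "(y, z) \<in> A_arcs n" for z
    using A_arcs_verts[OF that] colour_arc[OF that] by (simp add: c_def)
  then have Z: "?Z = {z \<in> ?C. (y, z) \<in> A_arcs n \<and> (z, x) \<in> A_arcs n}" by blast
  have "(\<Sum>k\<in>verts (D_graph n). \<Sum>\<beta>\<in>arcs_between (D_graph n) j k. \<Sum>\<gamma>\<in>arcs_between (D_graph n) k i.
       D_cell n \<alpha> \<beta> \<gamma> * cnj (D_cell n \<alpha>' \<beta> \<gamma>))
    = (\<Sum>z\<in>?C. \<Sum>\<beta>\<in>arcs_between (D_graph n) j (vertex_orbit n z).
        \<Sum>\<gamma>\<in>arcs_between (D_graph n) (vertex_orbit n z) i. D_cell n \<alpha> \<beta> \<gamma> * cnj (D_cell n \<alpha>' \<beta> \<gamma>))"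
    by (rule sum_orbits) (simp add: c_def)
  also have "\<dots> = (\<Sum>z\<in>?C. if (y, z) \<in> A_arcs n \<and> (z, x) \<in> A_arcs n
      then complex_of_real ((A_value n x y z)\<^sup>2) else 0)"
    by (intro sum.cong refl)
      (auto simp: C \<alpha>_eq \<open>\<alpha>' = \<alpha>\<close> D_cell_orbits xy power2_eq_square)
  also have "\<dots> = (\<Sum>z\<in>?Z. complex_of_real ((A_value n x y z)\<^sup>2))"
    unfolding Z using finite_A_verts by (intro sum.inter_filter[symmetric]) auto
  also have "\<dots> = complex_of_real (qint n 2 * A_eigenvector n x * A_eigenvector n y)"
    using horizontal_type_I[OF ab(1)] unfolding x_y_def of_real_sum[symmetric] by simp
  finally show "(\<Sum>k\<in>verts (D_graph n). \<Sum>\<beta>\<in>arcs_between (D_graph n) j k. \<Sum>\<gamma>\<in>arcs_between (D_graph n) k i.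
       D_cell n \<alpha> \<beta> \<gamma> * cnj (D_cell n \<alpha>' \<beta> \<gamma>))
    = of_bool (\<alpha> = \<alpha>') * complex_of_real (qint n 2 * D_eigenvector n i * D_eigenvector n j)"
    using \<open>\<alpha>' = \<alpha>\<close> v by (simp add: ij D_eigenvector_orbit)
qed

lemma type_II_D_cell: "type_II (D_graph n) (D_eigenvector n) (D_cell n)"
  unfolding type_II_def
proof (intro ballI)
  let ?G = "D_graph n"
  fix i1 i2 i3 i4 \<alpha>1 \<alpha>2 \<alpha>3 \<alpha>4
  assume i: "i3 \<in> verts ?G" "i4 \<in> verts ?G"
    and \<alpha>: "\<alpha>1 \<in> arcs_between ?G i1 i2" "\<alpha>2 \<in> arcs_between ?G i3 i2"
      "\<alpha>3 \<in> arcs_between ?G i3 i4" "\<alpha>4 \<in> arcs_between ?G i1 i4"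
  then have "\<alpha>1 \<in> arcs ?G" by (simp add: arcs_between_def)
  then obtain a b where ab: "a + b + 4 \<le> n" "\<alpha>1 = edge_orbit n ((a, b), (a + 1, b))"
    by (rule horizontal_representative)
  define x y where "x = (a, b)" "y = (a + 1, b)"
  have xy: "(x, y) \<in> A_arcs n" using horizontal_arc[OF ab(1)] by (simp add: x_y_def)
  note v = A_arcs_verts[OF xy]
  have \<alpha>1: "\<alpha>1 = edge_orbit n (x, y)" using ab(2) by (simp add: x_y_def)
  have i12: "i1 = vertex_orbit n x" "i2 = vertex_orbit n y"
    using \<alpha>(1) tail_edge_orbit[OF xy] head_edge_orbit[OF xy] \<alpha>1 by (auto simp: arcs_between_def)
  obtain x3 where x3: "x3 \<in> A_verts n" "vertex_orbit n x3 = i3" "colour x3 = colour x"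
    using i(1) colour_less[of x] by (rule lift_vertex)
  obtain x4 where x4: "x4 \<in> A_verts n" "vertex_orbit n x4 = i4" "colour x4 = colour y"
    using i(2) colour_less[of y] by (rule lift_vertex)
  have cy: "colour y = (colour x + 1) mod 3" by (rule colour_arc[OF xy])
  have arcs: "(x3, y) \<in> A_arcs n" "\<alpha>2 = edge_orbit n (x3, y)"
    "(x3, x4) \<in> A_arcs n" "\<alpha>3 = edge_orbit n (x3, x4)"
    "(x, x4) \<in> A_arcs n" "\<alpha>4 = edge_orbit n (x, x4)"
    using \<alpha>(2-4) arcs_between_orbits[of x3 y] arcs_between_orbits[of x3 x4] arcs_between_orbits[of x x4]
      v x3 x4 cy unfolding i12 x3(2)[symmetric] x4(2)[symmetric]
    by (simp_all split: if_splits)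
  define c where "c = (colour y + 1) mod 3"
  have cx: "colour x = (c + 1) mod 3"
    using colour_arc[OF xy] colour_cycle[of x] by (simp only: c_def)
  let ?P = "\<lambda>z. (y, z) \<in> A_arcs n \<and> (z, x) \<in> A_arcs n \<and> (z, x3) \<in> A_arcs n \<and> (x4, z) \<in> A_arcs n"
  let ?C = "{z. z \<in> A_verts n \<and> colour z = c}"
  have C: "arcs_between ?G i2 (vertex_orbit n z) = (if (y, z) \<in> A_arcs n then {edge_orbit n (y, z)} else {})"
    "arcs_between ?G (vertex_orbit n z) i1 = (if (z, x) \<in> A_arcs n then {edge_orbit n (z, x)} else {})"
    "arcs_between ?G (vertex_orbit n z) i3 = (if (z, x3) \<in> A_arcs n then {edge_orbit n (z, x3)} else {})"
    "arcs_between ?G i4 (vertex_orbit n z) = (if (x4, z) \<in> A_arcs n then {edge_orbit n (x4, z)} else {})"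
    "D_eigenvector n (vertex_orbit n z) = A_eigenvector n z"
    if "z \<in> ?C" for z
    unfolding i12 x3(2)[symmetric] x4(2)[symmetric] using that v cx x3 x4
    by (intro arcs_between_orbits D_eigenvector_orbit; simp add: c_def)+
  have "z \<in> ?C" if "(y, z) \<in> A_arcs n" for z
    using A_arcs_verts[OF that] colour_arc[OF that] by (simp add: c_def)
  then have Z: "{z. ?P z} = {z \<in> ?C. ?P z}" by blast
  let ?V = "A_value n"
  let ?w = "\<lambda>k \<beta>1 \<beta>2 \<beta>3 \<beta>4. complex_of_real (inverse (D_eigenvector n k)) *
            D_cell n \<alpha>1 \<beta>1 \<beta>2 * cnj (D_cell n \<alpha>2 \<beta>1 \<beta>3) * D_cell n \<alpha>3 \<beta>4 \<beta>3 * cnj (D_cell n \<alpha>4 \<beta>4 \<beta>2)"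
  let ?f = "\<lambda>z. ?V x y z * ?V x3 y z * ?V x3 x4 z * ?V x x4 z / A_eigenvector n z"
  have "(\<Sum>k\<in>verts ?G. \<Sum>\<beta>1\<in>arcs_between ?G i2 k. \<Sum>\<beta>2\<in>arcs_between ?G k i1.
         \<Sum>\<beta>3\<in>arcs_between ?G k i3. \<Sum>\<beta>4\<in>arcs_between ?G i4 k. ?w k \<beta>1 \<beta>2 \<beta>3 \<beta>4)
    = (\<Sum>z\<in>?C. \<Sum>\<beta>1\<in>arcs_between ?G i2 (vertex_orbit n z). \<Sum>\<beta>2\<in>arcs_between ?G (vertex_orbit n z) i1.
         \<Sum>\<beta>3\<in>arcs_between ?G (vertex_orbit n z) i3. \<Sum>\<beta>4\<in>arcs_between ?G i4 (vertex_orbit n z).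
         ?w (vertex_orbit n z) \<beta>1 \<beta>2 \<beta>3 \<beta>4)"
    by (rule sum_orbits) (simp add: c_def)
  also have "\<dots> = (\<Sum>z\<in>?C. if ?P z then complex_of_real (?f z) else 0)"
  proof (intro sum.cong refl)
    fix z assume z: "z \<in> ?C"
    show "(\<Sum>\<beta>1\<in>arcs_between ?G i2 (vertex_orbit n z). \<Sum>\<beta>2\<in>arcs_between ?G (vertex_orbit n z) i1.
         \<Sum>\<beta>3\<in>arcs_between ?G (vertex_orbit n z) i3. \<Sum>\<beta>4\<in>arcs_between ?G i4 (vertex_orbit n z).
         ?w (vertex_orbit n z) \<beta>1 \<beta>2 \<beta>3 \<beta>4) = (if ?P z then complex_of_real (?f z) else 0)"
    proof (cases "?P z")
      case True
      then show ?thesis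
        by (simp add: C[OF z] \<alpha>1 arcs D_cell_orbits xy divide_inverse mult_ac)
    next
      case False
      then show ?thesis by (auto simp: C(1-4)[OF z])
    qed
  qed
  also have "\<dots> = (\<Sum>z | ?P z. complex_of_real (?f z))"
    unfolding Z using finite_A_verts by (intro sum.inter_filter[symmetric]) auto
  also have "\<dots> = complex_of_real (of_bool (y = x4) * (A_eigenvector n x * A_eigenvector n y * A_eigenvector n x3)
    + of_bool (x = x3) * (A_eigenvector n x * A_eigenvector n y * A_eigenvector n x4))"
    using horizontal_type_II[OF ab(1), of x3 x4] arcs unfolding x_y_def of_real_sum[symmetric] by simp
  also have "\<dots> = of_bool (\<alpha>1 = \<alpha>4) * of_bool (\<alpha>2 = \<alpha>3) *
          complex_of_real (D_eigenvector n i1 * D_eigenvector n i2 * D_eigenvector n i3)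
        + of_bool (\<alpha>1 = \<alpha>2) * of_bool (\<alpha>3 = \<alpha>4) *
          complex_of_real (D_eigenvector n i1 * D_eigenvector n i2 * D_eigenvector n i4)"
  proof -
    have heads: "y = x4" if "\<alpha>1 = \<alpha>4"
      using that head_edge_orbit[OF xy] head_edge_orbit[OF arcs(5)] v x4(1,3) \<alpha>1 arcs(6)
      by (intro same_orbit_same_colour[OF n3]) auto
    have tails: "x = x3" if "\<alpha>1 = \<alpha>2"
      using that tail_edge_orbit[OF xy] tail_edge_orbit[OF arcs(1)] v x3(1,3) \<alpha>1 arcs(2)
      by (intro same_orbit_same_colour[OF n3]) auto
    have "\<alpha>1 = \<alpha>4 \<longleftrightarrow> y = x4" by (rule iffI[OF heads]) (simp_all only: \<alpha>1 arcs)
    moreover have "\<alpha>1 = \<alpha>2 \<longleftrightarrow> x = x3" by (rule iffI[OF tails]) (simp_all only: \<alpha>1 arcs)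
    moreover have "y = x4 \<Longrightarrow> \<alpha>2 = \<alpha>3" "x = x3 \<Longrightarrow> \<alpha>3 = \<alpha>4" by (simp_all only: arcs)
    moreover have "D_eigenvector n i1 = A_eigenvector n x" "D_eigenvector n i2 = A_eigenvector n y"
      "D_eigenvector n i3 = A_eigenvector n x3" "D_eigenvector n i4 = A_eigenvector n x4"
      unfolding i12 x3(2)[symmetric] x4(2)[symmetric] using v x3(1) x4(1)
      by (simp_all only: D_eigenvector_orbit)
    ultimately show ?thesis by (cases "y = x4"; cases "x = x3") simp_all
  qed
  finally show "(\<Sum>k\<in>verts ?G. \<Sum>\<beta>1\<in>arcs_between ?G i2 k. \<Sum>\<beta>2\<in>arcs_between ?G k i1.
         \<Sum>\<beta>3\<in>arcs_between ?G k i3. \<Sum>\<beta>4\<in>arcs_between ?G i4 k. ?w k \<beta>1 \<beta>2 \<beta>3 \<beta>4)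
    = of_bool (\<alpha>1 = \<alpha>4) * of_bool (\<alpha>2 = \<alpha>3) *
          complex_of_real (D_eigenvector n i1 * D_eigenvector n i2 * D_eigenvector n i3)
        + of_bool (\<alpha>1 = \<alpha>2) * of_bool (\<alpha>3 = \<alpha>4) *
          complex_of_real (D_eigenvector n i1 * D_eigenvector n i2 * D_eigenvector n i4)" .
qed

lemma orbifold_solution_D_cell: "orbifold_solution n (D_cell n)"
proof -
  have "cmod (D_cell n \<alpha> \<beta> \<gamma>) = w"
    if t: "triangle (D_graph n) \<alpha> \<beta> \<gamma>" and w: "D_cell_value n \<alpha> \<beta> \<gamma> w" for \<alpha> \<beta> \<gamma> w
  proof -
    obtain x y where xy: "(x, y) \<in> A_arcs n" "\<alpha> = edge_orbit n (x, y)" using t by (auto simp: triangle_def)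
    obtain z where z: "(y, z) \<in> A_arcs n" "(z, x) \<in> A_arcs n"
      "\<beta> = edge_orbit n (y, z)" "\<gamma> = edge_orbit n (z, x)"
      using lift_triangle[OF t[unfolded xy(2)] xy(1)] by blast
    have "A_value n x y z > 0" using A_value_pos A_arcs_verts xy(1) z by blast
    moreover have "w = A_value n x y z" using w D_cell_value_iff[OF xy(1) z(1,2)] xy(2) z by simp
    ultimately show ?thesis using D_cell_orbits[OF xy(1) z(1,2)] xy(2) z by simp
  qed
  then show ?thesis
    unfolding orbifold_solution_def cell_system_def
    using rotation_invariant_D_cell type_I_D_cell type_II_D_cell by blast
qed

end

section \<open>Prescribing the products of phases around triangles\<close>

text \<open>
  A system of equations \<open>u (e1 t) * u (e2 t) * u (e3 t) = \<theta> t\<close> in unknown phases on edges is solved by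
  adding the triangles in order of increasing rank of \<open>e1\<close>. When \<open>t\<close> is added, no earlier equation
  mentions \<open>e1 t\<close>, so this phase can be redefined freely to satisfy the equation of \<open>t\<close>. The only
  other possibility is a cone: a triangle all of whose edges coincide, for which a cube root is
  taken.
\<close>

lemma peeling_phases:
  fixes e1 e2 e3 :: "'i \<Rightarrow> 'e" and r :: "'e \<Rightarrow> int" and \<theta> :: "'i \<Rightarrow> complex"
  assumes "finite T"
    and unit: "\<And>t. t \<in> T \<Longrightarrow> cmod (\<theta> t) = 1"
    and free_or_cone: "\<And>t. t \<in> T \<Longrightarrow> e1 t \<notin> {e2 t, e3 t} \<or> e1 t = e2 t \<and> e1 t = e3 t"
    and inj: "inj_on e1 T"
    and rank: "\<And>t t'. t \<in> T \<Longrightarrow> t' \<in> T \<Longrightarrow> t \<noteq> t' \<Longrightarrow> e1 t \<in> {e2 t', e3 t'} \<Longrightarrow> r (e1 t) < r (e1 t')"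
  shows "\<exists>u. (\<forall>e. cmod (u e) = 1) \<and> (\<forall>t\<in>T. u (e1 t) * u (e2 t) * u (e3 t) = \<theta> t)"
  using assms
proof (induction T rule: finite_ranking_induct[where f = "\<lambda>t. r (e1 t)"])
  case empty
  show ?case by (intro exI[of _ "\<lambda>_. 1"]) simp
next
  case (insert t S)
  have "\<exists>u. (\<forall>e. cmod (u e) = 1) \<and> (\<forall>t\<in>S. u (e1 t) * u (e2 t) * u (e3 t) = \<theta> t)"
    by (rule insert.IH) (use insert.prems in \<open>auto simp: inj_on_def\<close>)
  then obtain u where u: "\<And>e. cmod (u e) = 1"
    and S: "\<And>s. s \<in> S \<Longrightarrow> u (e1 s) * u (e2 s) * u (e3 s) = \<theta> s" by blast
  show ?case
  proof (cases "t \<in> S")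
    case True
    then show ?thesis using u S by (intro exI[of _ u]) auto
  next
    case False
    have fresh: "e1 t \<notin> {e1 s, e2 s, e3 s}" if "s \<in> S" for s
    proof -
      have "s \<noteq> t" using False that by blast
      then have "e1 t \<noteq> e1 s" using insert.prems(3) that by (auto simp: inj_on_def)
      moreover have "\<not> r (e1 t) < r (e1 s)" using insert.hyps that by force
      ultimately show ?thesis using insert.prems(4)[of t s] that \<open>s \<noteq> t\<close> by auto
    qed
    have "\<exists>c. cmod c = 1 \<and> (u(e1 t := c)) (e1 t) * (u(e1 t := c)) (e2 t) * (u(e1 t := c)) (e3 t) = \<theta> t"
    proof (cases "e1 t \<in> {e2 t, e3 t}")
      case True
      then have cone: "e2 t = e1 t" "e3 t = e1 t" using insert.prems(2)[of t] by auto
      have "\<theta> t = cis (Arg (\<theta> t))"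
        using insert.prems(1)[of t] rcis_cmod_Arg[of "\<theta> t"] by (simp add: rcis_def)
      also have "\<dots> = cis (Arg (\<theta> t) / 3) * cis (Arg (\<theta> t) / 3) * cis (Arg (\<theta> t) / 3)"
        by (simp add: cis_mult)
      finally show ?thesis using cone
        by (intro exI[of _ "cis (Arg (\<theta> t) / 3)"] conjI) (simp_all only: fun_upd_same norm_cis)
    next
      case False
      have "u (e2 t) \<noteq> 0" "u (e3 t) \<noteq> 0" using u[of "e2 t"] u[of "e3 t"] by auto
      then show ?thesis using False u[of "e2 t"] u[of "e3 t"] insert.prems(1)[of t]
        by (intro exI[of _ "\<theta> t / (u (e2 t) * u (e3 t))"]) (auto simp: norm_divide norm_mult)
    qed
    then obtain c where c: "cmod c = 1"
      "(u(e1 t := c)) (e1 t) * (u(e1 t := c)) (e2 t) * (u(e1 t := c)) (e3 t) = \<theta> t" by blast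
    show ?thesis
    proof (intro exI[of _ "u(e1 t := c)"] conjI allI ballI)
      show "cmod ((u(e1 t := c)) e) = 1" for e using c(1) u by simp
      show "(u(e1 t := c)) (e1 s) * (u(e1 t := c)) (e2 s) * (u(e1 t := c)) (e3 s) = \<theta> s"
        if "s \<in> insert t S" for s
        using that c(2) fresh[of s] S[of s] by (cases "s = t") auto
    qed
  qed
qed

text \<open>
  The next lemma concerns a triangular board with vertices \<open>(a, b, c)\<close>, \<open>a + b + c = M + 1\<close>, modulo
  the cyclic permutations of coordinates. Up to rotation, an edge is constant in the first
  coordinate; the triple \<open>(a, b, c)\<close> with sum \<open>M\<close> stands for the edge between \<open>(a, b + 1, c)\<close> and
  \<open>(a, b, c + 1)\<close>. An upward triangle has the three rotations of one such triple as its edges, and a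
  downward triangle, indexed by a triple with sum \<open>M - 1\<close>, has the edges obtained by increasing one
  coordinate and rotating it to the front. Each
  triangle needs a free edge pointing away from the centre of the board: this is the edge with the
  smallest first coordinate for an upward and with the largest one for a downward triangle. The two
  predicates choose the rotation of the index that puts the free edge first. Mixing strict and
  non-strict inequalities breaks ties between two coordinates; if all three agree, the triangle is
  the central one, and it is a cone.
\<close>

definition up_free :: "nat \<times> nat \<times> nat \<Rightarrow> bool" where
  "up_free = (\<lambda>(a, b, c). a \<le> b \<and> a < c \<or> a = b \<and> b = c)"

definition down_free :: "nat \<times> nat \<times> nat \<Rightarrow> bool" where
  "down_free = (\<lambda>(a, b, c). a \<ge> b \<and> a > c \<or> a = b \<and> b = c)"

lemma up_free_rotation: "up_free (a, b, c) \<or> up_free (b, c, a) \<or> up_free (c, a, b)"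
  by (auto simp: up_free_def)

lemma down_free_rotation: "down_free (a, b, c) \<or> down_free (b, c, a) \<or> down_free (c, a, b)"
  by (auto simp: down_free_def)

text \<open>
  The rank for the peeling argument measures the distance between the midpoint of an edge and the
  centre of the board. The midpoint of \<open>(a, b, c)\<close> is \<open>(a, b + 1/2, c + 1/2)\<close>, whose squared norm is
  \<open>a\<^sup>2 + b\<^sup>2 + c\<^sup>2 - a\<close> up to a constant, because \<open>a + b + c\<close> is fixed. Among the edges of a
  triangle the one pointing outward most has the farthest midpoint; at a tie, the edge that is not
  chosen is free for no triangle at all.
\<close>

lemma phases_on_triples:
  fixes \<theta> \<eta> :: "nat \<Rightarrow> nat \<Rightarrow> nat \<Rightarrow> complex" and M :: nat
  assumes \<theta>1: "\<And>a b c. a + b + c = M \<Longrightarrow> cmod (\<theta> a b c) = 1"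
    and \<theta>rot: "\<And>a b c. a + b + c = M \<Longrightarrow> \<theta> a b c = \<theta> b c a"
    and \<eta>1: "\<And>a b c. a + b + c + 1 = M \<Longrightarrow> cmod (\<eta> a b c) = 1"
    and \<eta>rot: "\<And>a b c. a + b + c + 1 = M \<Longrightarrow> \<eta> a b c = \<eta> b c a"
  shows "\<exists>v. (\<forall>x. cmod (v x) = 1) \<and>
    (\<forall>a b c. a + b + c = M \<longrightarrow> v (a, b, c) * v (b, c, a) * v (c, a, b) = \<theta> a b c) \<and>
    (\<forall>a b c. a + b + c + 1 = M \<longrightarrow>
       v (a + 1, b, c) * v (c + 1, a, b) * v (b + 1, c, a) = \<eta> a b c)"
proof -
  define e1 :: "bool \<times> nat \<times> nat \<times> nat \<Rightarrow> nat \<times> nat \<times> nat"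
    where "e1 = (\<lambda>(up, a, b, c). if up then (a, b, c) else (a + 1, b, c))"
  define e2 :: "bool \<times> nat \<times> nat \<times> nat \<Rightarrow> nat \<times> nat \<times> nat"
    where "e2 = (\<lambda>(up, a, b, c). if up then (b, c, a) else (c + 1, a, b))"
  define e3 :: "bool \<times> nat \<times> nat \<times> nat \<Rightarrow> nat \<times> nat \<times> nat"
    where "e3 = (\<lambda>(up, a, b, c). if up then (c, a, b) else (b + 1, c, a))"
  define r :: "nat \<times> nat \<times> nat \<Rightarrow> int"
    where "r = (\<lambda>(a, b, c). int a ^ 2 + int b ^ 2 + int c ^ 2 - int a)"
  define T where "T = {(up, a, b, c). if up then a + b + c = M \<and> up_free (a, b, c)
                         else a + b + c + 1 = M \<and> down_free (a, b, c)}"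
  define \<zeta> where "\<zeta> = (\<lambda>(up, a, b, c). if up then \<theta> a b c else \<eta> a b c)"
  have "T \<subseteq> UNIV \<times> {..M} \<times> {..M} \<times> {..M}" by (auto simp: T_def split: if_splits)
  then have fin: "finite T" by (rule finite_subset) auto
  have inj: "inj_on e1 T"
    by (auto simp: inj_on_def T_def e1_def up_free_def down_free_def split: if_splits)
  have unit: "cmod (\<zeta> t) = 1" if "t \<in> T" for t
    using that \<theta>1 \<eta>1 by (auto simp: T_def \<zeta>_def split: if_splits)
  have free: "e1 t \<notin> {e2 t, e3 t} \<or> e1 t = e2 t \<and> e1 t = e3 t" if "t \<in> T" for t
    using that by (auto simp: T_def e1_def e2_def e3_def up_free_def down_free_def split: if_splits)
  have rank: "r (e1 t) < r (e1 t')"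
    if "t \<in> T" "t' \<in> T" "t \<noteq> t'" "e1 t \<in> {e2 t', e3 t'}" for t t'
  proof -
    obtain up a b c where t: "t = (up, a, b, c)" by (cases t) auto
    obtain up' a' b' c' where t': "t' = (up', a', b', c')" by (cases t') auto
    have t_free: "up \<Longrightarrow> up_free (e1 t)" "\<not> up \<Longrightarrow> e1 t = (a + 1, b, c) \<and> down_free (a, b, c)"
      using that(1) unfolding t by (simp_all add: T_def e1_def)
    show ?thesis
    proof (cases up')
      case True
      have "up_free (a', b', c')" using that(2) True unfolding t' by (simp add: T_def)
      moreover have "e1 t = (b', c', a') \<or> e1 t = (c', a', b')"
        using that(4) True unfolding t' by (simp add: e2_def e3_def)
      moreover have "\<not> up \<or> e1 t \<noteq> (a', b', c')"
        using that(3) True unfolding t t' by (simp add: e1_def)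
      ultimately have "e1 t = (b', c', a') \<and> a' < b' \<or> e1 t = (c', a', b') \<and> a' < c'"
        using t_free by (cases up) (auto simp: up_free_def down_free_def)
      \<comment> \<open>The edges of an upward triangle differ in rank only by their first coordinates.\<close>
      then show ?thesis using True unfolding t' by (auto simp: r_def e1_def)
    next
      case False
      have "down_free (a', b', c')" using that(2) False unfolding t' by (simp add: T_def)
      moreover have "e1 t = (c' + 1, a', b') \<or> e1 t = (b' + 1, c', a')"
        using that(4) False unfolding t' by (simp add: e2_def e3_def)
      moreover have "up \<or> (a, b, c) \<noteq> (a', b', c')"
        using that(3) False unfolding t t' by simp
      ultimately have "e1 t = (c' + 1, a', b') \<and> c' < a' \<or> e1 t = (b' + 1, c', a') \<and> b' < a'"
        using t_free by (cases up) (auto simp: up_free_def down_free_def)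
      then show ?thesis using False unfolding t'
        by (auto simp: r_def e1_def power2_eq_square algebra_simps)
    qed
  qed
  obtain v where v: "\<And>x. cmod (v x) = 1"
    and T: "\<And>t. t \<in> T \<Longrightarrow> v (e1 t) * v (e2 t) * v (e3 t) = \<zeta> t"
    using peeling_phases[where T = T and r = r and \<theta> = \<zeta>, OF fin unit free inj rank] by blast
  have up: "v (a, b, c) * v (b, c, a) * v (c, a, b) = \<theta> a b c"
    if "a + b + c = M" "up_free (a, b, c)" for a b c
    using T[of "(True, a, b, c)"] that by (simp add: T_def e1_def e2_def e3_def \<zeta>_def)
  have down: "v (a + 1, b, c) * v (c + 1, a, b) * v (b + 1, c, a) = \<eta> a b c"
    if "a + b + c + 1 = M" "down_free (a, b, c)" for a b c
    using T[of "(False, a, b, c)"] that by (simp add: T_def e1_def e2_def e3_def \<zeta>_def)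
  show ?thesis
  proof (intro exI[of _ v] conjI allI impI v)
    fix a b c assume s: "a + b + c = M"
    then have "b + c + a = M" "c + a + b = M" by auto
    with s show "v (a, b, c) * v (b, c, a) * v (c, a, b) = \<theta> a b c"
      using up_free_rotation[of a b c] up[of a b c] up[of b c a] up[of c a b]
        \<theta>rot[of a b c] \<theta>rot[of b c a] by (auto simp: mult_ac)
  next
    fix a b c assume s: "a + b + c + 1 = M"
    then have "b + c + a + 1 = M" "c + a + b + 1 = M" by auto
    with s show "v (a + 1, b, c) * v (c + 1, a, b) * v (b + 1, c, a) = \<eta> a b c"
      using down_free_rotation[of a b c] down[of a b c] down[of b c a] down[of c a b]
        \<eta>rot[of a b c] \<eta>rot[of b c a] by (auto simp: mult_ac)
  qed
qed

section \<open>Equivalence of orbifold solutions\<close>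

text \<open>
  An arc of the quotient has a unique horizontal representative, here \<open>(q, h) \<rightarrow> (q + 1, h)\<close>; with
  \<open>p = n - 4 - h - q\<close> the arcs correspond to the triples \<open>(h, p, q)\<close> with sum \<open>n - 4\<close>. The number \<open>h\<close>
  is the height of the line that contains the arc, and \<open>p\<close>, \<open>q\<close> are the distances of the arc from the
  two ends of this line.
\<close>

fun D_arc :: "nat \<Rightarrow> nat \<times> nat \<times> nat \<Rightarrow> edge set" where
  "D_arc n (h, p, q) = edge_orbit n ((q, h), (q + 1, h))"

lemma edge_orbit_up:
  assumes "h + p + q + 4 = n"
  shows "edge_orbit n ((q + 1, h), (q, h + 1)) = D_arc n (p, q, h)"
    and "edge_orbit n ((q, h + 1), (q, h)) = D_arc n (q, h, p)"
proof -
  have 1: "((h, p), (h + 1, p)) \<in> A_arcs n" "((p, q), (p + 1, q)) \<in> A_arcs n"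
    using assms by (auto simp: A_arcs_def A_verts_def)
  have "rot n (h, p) = (q + 1, h)" "rot n (h + 1, p) = (q, h + 1)"
    "rot n (rot n (p, q)) = (q, h + 1)" "rot n (rot n (p + 1, q)) = (q, h)"
    using assms by (auto simp: rot.simps)
  then show "edge_orbit n ((q + 1, h), (q, h + 1)) = D_arc n (p, q, h)"
    "edge_orbit n ((q, h + 1), (q, h)) = D_arc n (q, h, p)"
    using edge_orbit_rot[OF 1(1)] edge_orbit_rot[OF 1(2)] edge_orbit_rot[OF rot_in_arcs[OF 1(2)]] by simp_all
qed

lemma edge_orbit_down:
  assumes "h + p + q + 5 = n"
  shows "edge_orbit n ((q + 1, h + 1), (q + 1, h)) = D_arc n (q + 1, h, p)"
    and "edge_orbit n ((q + 1, h), (q, h + 1)) = D_arc n (p + 1, q, h)"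
  using edge_orbit_up(2)[of h p "q + 1" n] edge_orbit_up(1)[of h "p + 1" q n] assms
  by simp_all

lemma edge_orbit_triangle:
  assumes "(x, y) \<in> A_arcs n" "(y, z) \<in> A_arcs n" "(z, x) \<in> A_arcs n"
  shows "triangle (D_graph n) (edge_orbit n (x, y)) (edge_orbit n (y, z)) (edge_orbit n (z, x))"
  using assms tail_edge_orbit[OF assms(1)] tail_edge_orbit[OF assms(2)] tail_edge_orbit[OF assms(3)]
    head_edge_orbit[OF assms(1)] head_edge_orbit[OF assms(2)] head_edge_orbit[OF assms(3)]
  by (simp add: triangle_def)

lemma D_arc_up_triangle:
  assumes "h + p + q + 4 = n"
  shows "triangle (D_graph n) (D_arc n (h, p, q)) (D_arc n (p, q, h)) (D_arc n (q, h, p))"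
proof -
  have "((q, h), (q + 1, h)) \<in> A_arcs n" "((q + 1, h), (q, h + 1)) \<in> A_arcs n" "((q, h + 1), (q, h)) \<in> A_arcs n"
    using assms by (auto simp: A_arcs_def A_verts_def)
  from edge_orbit_triangle[OF this] show ?thesis by (simp only: edge_orbit_up[OF assms] D_arc.simps)
qed

lemma D_arc_down_triangle:
  assumes "h + p + q + 5 = n"
  shows "triangle (D_graph n) (D_arc n (h + 1, p, q)) (D_arc n (q + 1, h, p)) (D_arc n (p + 1, q, h))"
proof -
  have "((q, h + 1), (q + 1, h + 1)) \<in> A_arcs n" "((q + 1, h + 1), (q + 1, h)) \<in> A_arcs n"
    "((q + 1, h), (q, h + 1)) \<in> A_arcs n"
    using assms by (auto simp: A_arcs_def A_verts_def)
  from edge_orbit_triangle[OF this] show ?thesis by (simp only: edge_orbit_down[OF assms] D_arc.simps)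
qed

lemma inj_on_D_arc: "inj_on (D_arc n) {(h, p, q). h + p + q + 4 = n}"
proof (rule inj_onI)
  fix t t' assume tt': "t \<in> {(h, p, q). h + p + q + 4 = n}" "t' \<in> {(h, p, q). h + p + q + 4 = n}"
    and D: "D_arc n t = D_arc n t'"
  obtain h p q h' p' q' where t: "t = (h, p, q)" "t' = (h', p', q')" by (metis prod_cases3)
  have s: "h + p + q + 4 = n" "h' + p' + q' + 4 = n" and eq: "D_arc n (h, p, q) = D_arc n (h', p', q')"
    using tt' D by (simp_all add: t)
  have arc: "((q, h), (q + 1, h)) \<in> A_arcs n" "((q', h'), (q' + 1, h')) \<in> A_arcs n"
    using s by (auto simp: A_arcs_def A_verts_def)
  have "((q', h'), (q' + 1, h')) \<in> edge_orbit n ((q, h), (q + 1, h))"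
    using eq edge_orbit_eq[OF arc(2)] by simp
  moreover have "edge_orbit n ((q, h), (q + 1, h)) =
      {((q, h), (q + 1, h)), ((p + 1, q), (p, q + 1)), ((h, p + 1), (h, p))}"
  proof -
    have "rot n (q, h) = (p + 1, q)" "rot n (q + 1, h) = (p, q + 1)"
      "rot n (p + 1, q) = (h, p + 1)" "rot n (p, q + 1) = (h, p)"
      using s(1) by (simp_all add: rot.simps)
    then show ?thesis unfolding edge_orbit_eq[OF arc(1)] by simp
  qed
  ultimately show "t = t'"
    using s by (auto simp: t)
qed

context
  fixes n :: nat
  assumes n3: "n mod 3 \<noteq> 0"
begin

text \<open>In these coordinates the triangles of the quotient are those of \<open>phases_on_triples\<close>.\<close>

lemma D_triangle_cases:
  assumes t: "triangle (D_graph n) \<alpha> \<beta> \<gamma>"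
  obtains (up) h p q where "h + p + q + 4 = n"
      "\<alpha> = D_arc n (h, p, q)" "\<beta> = D_arc n (p, q, h)" "\<gamma> = D_arc n (q, h, p)"
    | (down) h p q where "h + p + q + 5 = n"
      "\<alpha> = D_arc n (h + 1, p, q)" "\<beta> = D_arc n (q + 1, h, p)" "\<gamma> = D_arc n (p + 1, q, h)"
proof -
  have "\<alpha> \<in> arcs (D_graph n)" using t by (simp add: triangle_def)
  then obtain a b where ab: "a + b + 4 \<le> n" "\<alpha> = edge_orbit n ((a, b), (a + 1, b))"
    by (rule horizontal_representative)
  obtain z where z: "((a + 1, b), z) \<in> A_arcs n" "(z, (a, b)) \<in> A_arcs n"
    "\<beta> = edge_orbit n ((a + 1, b), z)" "\<gamma> = edge_orbit n (z, (a, b))"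
    using lift_triangle[OF n3 t[unfolded ab(2)] horizontal_arc[OF ab(1)]] by blast
  consider "z = (a, b + 1)" | b' where "b = b' + 1" "z = (a + 1, b')"
    using third_vertex_iff[OF ab(1)] z(1,2) by blast
  then show thesis
  proof cases
    case 1
    have "b + (n - 4 - a - b) + a + 4 = n" using ab(1) by simp
    then show thesis using up[of b "n - 4 - a - b" a] edge_orbit_up[of b "n - 4 - a - b" a n] 1 ab z by simp
  next
    case 2
    have "b' + (n - 5 - a - b') + a + 5 = n" using ab(1) 2 by simp
    then show thesis
      using down[of b' "n - 5 - a - b'" a] edge_orbit_down[of b' "n - 5 - a - b'" a n] 2 ab z by simp
  qed
qed

lemma arcs_between_at_most_one:
  assumes "\<sigma> \<in> arcs_between (D_graph n) i j"
  shows "arcs_between (D_graph n) i j = {\<sigma>}"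
proof -
  have "\<sigma> \<in> arcs (D_graph n)" using assms by (simp add: arcs_between_def)
  then obtain x y where xy: "(x, y) \<in> A_arcs n" "\<sigma> = edge_orbit n (x, y)" by auto
  then have ij: "i = vertex_orbit n x" "j = vertex_orbit n y"
    using assms tail_edge_orbit[OF xy(1)] head_edge_orbit[OF xy(1)] by (auto simp: arcs_between_def)
  show ?thesis
    using arcs_between_orbits[OF n3, of x y] A_arcs_verts[OF xy(1)] colour_arc[OF xy(1)] xy by (simp add: ij)
qed

lemma orbifold_solution_cmod:
  assumes W: "orbifold_solution n W" and t: "triangle (D_graph n) \<alpha> \<beta> \<gamma>"
  shows "cmod (W \<alpha> \<beta> \<gamma>) = cmod (D_cell n \<alpha> \<beta> \<gamma>)" "D_cell n \<alpha> \<beta> \<gamma> \<noteq> 0"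
proof -
  obtain x y where xy: "(x, y) \<in> A_arcs n" "\<alpha> = edge_orbit n (x, y)" using t by (auto simp: triangle_def)
  obtain z where z: "(y, z) \<in> A_arcs n" "(z, x) \<in> A_arcs n"
    "\<beta> = edge_orbit n (y, z)" "\<gamma> = edge_orbit n (z, x)"
    using lift_triangle[OF n3 t[unfolded xy(2)] xy(1)] by blast
  have pos: "A_value n x y z > 0" using A_value_pos A_arcs_verts xy(1) z by blast
  have w: "D_cell_value n \<alpha> \<beta> \<gamma> (A_value n x y z)"
    using D_cell_value_iff[OF n3 xy(1) z(1,2)] xy(2) z by simp
  have D: "D_cell n \<alpha> \<beta> \<gamma> = complex_of_real (A_value n x y z)"
    using D_cell_orbits[OF n3 xy(1) z(1,2)] xy(2) z by simp
  show "D_cell n \<alpha> \<beta> \<gamma> \<noteq> 0" using D pos by simp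
  have "cmod (W \<alpha> \<beta> \<gamma>) = A_value n x y z" using W w t unfolding orbifold_solution_def by blast
  then show "cmod (W \<alpha> \<beta> \<gamma>) = cmod (D_cell n \<alpha> \<beta> \<gamma>)" using D pos by simp
qed

text \<open>
  The quotient of two orbifold solutions is a phase on every triangle, and the gauge
  transformation is a solution \<open>v\<close> of the corresponding system of equations for phases on arcs. As
  there is at most one arc between two vertices, the unitary matrices are just these phases.
\<close>

lemma equivalent_to_D_cell:
  assumes W: "orbifold_solution n W" and n4: "n \<ge> 4"
  shows "equivalent_cells (D_graph n) W (D_cell n)"
proof -
  define ratio where "ratio \<alpha> \<beta> \<gamma> = W \<alpha> \<beta> \<gamma> / D_cell n \<alpha> \<beta> \<gamma>" for \<alpha> \<beta> \<gamma>
  have ratio_1: "cmod (ratio \<alpha> \<beta> \<gamma>) = 1" if "triangle (D_graph n) \<alpha> \<beta> \<gamma>" for \<alpha> \<beta> \<gamma>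
    using orbifold_solution_cmod[OF W that] by (simp add: ratio_def norm_divide)
  have "rotation_invariant (D_graph n) W"
    using W by (simp add: orbifold_solution_def cell_system_def)
  then have ratio_rot: "ratio \<alpha> \<beta> \<gamma> = ratio \<beta> \<gamma> \<alpha>" if "triangle (D_graph n) \<alpha> \<beta> \<gamma>" for \<alpha> \<beta> \<gamma>
    using rotation_invariant_D_cell[OF n3] that unfolding rotation_invariant_def ratio_def by metis
  let ?F = "D_arc n"
  have "\<exists>v. (\<forall>x. cmod (v x) = 1) \<and>
    (\<forall>a b c. a + b + c = n - 4 \<longrightarrow> v (a, b, c) * v (b, c, a) * v (c, a, b) = ratio (?F (a, b, c)) (?F (b, c, a)) (?F (c, a, b))) \<and>
    (\<forall>a b c. a + b + c + 1 = n - 4 \<longrightarrow>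
       v (a + 1, b, c) * v (c + 1, a, b) * v (b + 1, c, a) =
       ratio (?F (a + 1, b, c)) (?F (c + 1, a, b)) (?F (b + 1, c, a)))"
  proof (rule phases_on_triples)
    fix a b c assume s: "a + b + c = n - 4"
    then have t: "triangle (D_graph n) (?F (a, b, c)) (?F (b, c, a)) (?F (c, a, b))"
      using n4 by (intro D_arc_up_triangle) simp
    show "cmod (ratio (?F (a, b, c)) (?F (b, c, a)) (?F (c, a, b))) = 1" by (rule ratio_1[OF t])
    show "ratio (?F (a, b, c)) (?F (b, c, a)) (?F (c, a, b)) = ratio (?F (b, c, a)) (?F (c, a, b)) (?F (a, b, c))"
      by (rule ratio_rot[OF t])
  next
    fix a b c assume s: "a + b + c + 1 = n - 4"
    then have "a + b + c + 5 = n" "b + c + a + 5 = n" by simp_all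
    then have t: "triangle (D_graph n) (?F (a + 1, b, c)) (?F (c + 1, a, b)) (?F (b + 1, c, a))"
      and t': "triangle (D_graph n) (?F (b + 1, c, a)) (?F (a + 1, b, c)) (?F (c + 1, a, b))"
      by (simp_all only: D_arc_down_triangle)
    show "cmod (ratio (?F (a + 1, b, c)) (?F (c + 1, a, b)) (?F (b + 1, c, a))) = 1" by (rule ratio_1[OF t])
    show "ratio (?F (a + 1, b, c)) (?F (c + 1, a, b)) (?F (b + 1, c, a)) =
        ratio (?F (b + 1, c, a)) (?F (a + 1, b, c)) (?F (c + 1, a, b))"
      by (rule ratio_rot[OF t', symmetric])
  qed
  then obtain v where v1: "\<And>x. cmod (v x) = 1"
    and v_up: "\<And>a b c. a + b + c = n - 4 \<Longrightarrow>
      v (a, b, c) * v (b, c, a) * v (c, a, b) = ratio (?F (a, b, c)) (?F (b, c, a)) (?F (c, a, b))"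
    and v_down: "\<And>a b c. a + b + c + 1 = n - 4 \<Longrightarrow>
      v (a + 1, b, c) * v (c + 1, a, b) * v (b + 1, c, a) =
       ratio (?F (a + 1, b, c)) (?F (c + 1, a, b)) (?F (b + 1, c, a))"
    by blast
  define T where "T = {(h, p, q). h + p + q + 4 = n}"
  define g where "g \<alpha> = v (the_inv_into T ?F \<alpha>)" for \<alpha>
  define u where "u \<sigma> \<sigma>' = (if \<sigma> = \<sigma>' then g \<sigma> else 0)" for \<sigma> \<sigma>'
  have g_F: "g (?F x) = v x" if "x \<in> T" for x
    using the_inv_into_f_f[OF inj_on_D_arc] that by (simp add: g_def T_def)
  have g1: "g \<alpha> * cnj (g \<alpha>) = 1" "cnj (g \<alpha>) * g \<alpha> = 1" for \<alpha>
    using v1[of "the_inv_into T ?F \<alpha>"] by (simp_all add: g_def complex_norm_square[symmetric] mult.commute)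
  have W_eq: "W \<alpha> \<beta> \<gamma> = g \<alpha> * g \<beta> * g \<gamma> * D_cell n \<alpha> \<beta> \<gamma>" if t: "triangle (D_graph n) \<alpha> \<beta> \<gamma>" for \<alpha> \<beta> \<gamma>
  proof -
    have "g \<alpha> * g \<beta> * g \<gamma> = ratio \<alpha> \<beta> \<gamma>"
      using t
    proof (cases rule: D_triangle_cases)
      case (up h p q)
      then have "(h, p, q) \<in> T" "(p, q, h) \<in> T" "(q, h, p) \<in> T" by (auto simp: T_def)
      then show ?thesis using v_up[of h p q] up by (simp add: g_F del: D_arc.simps)
    next
      case (down h p q)
      then have "(h + 1, p, q) \<in> T" "(q + 1, h, p) \<in> T" "(p + 1, q, h) \<in> T" by (auto simp: T_def)
      then show ?thesis using v_down[of h p q] down by (simp only: g_F)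
    qed
    then show ?thesis using orbifold_solution_cmod(2)[OF W t] by (simp add: ratio_def)
  qed
  show ?thesis
    unfolding equivalent_cells_def
  proof (intro exI[of _ u] conjI ballI)
    fix i j
    show "unitary_on (arcs_between (D_graph n) i j) u"
    proof (cases "arcs_between (D_graph n) i j = {}")
      case False
      then obtain \<sigma> where "\<sigma> \<in> arcs_between (D_graph n) i j" by blast
      then have "arcs_between (D_graph n) i j = {\<sigma>}" by (rule arcs_between_at_most_one)
      then show ?thesis by (simp add: unitary_on_def u_def g1)
    qed (simp add: unitary_on_def)
  next
    fix i j k \<sigma> \<rho> \<gamma>
    assume a: "\<sigma> \<in> arcs_between (D_graph n) i j" "\<rho> \<in> arcs_between (D_graph n) j k" "\<gamma> \<in> arcs_between (D_graph n) k i"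
    then have "triangle (D_graph n) \<sigma> \<rho> \<gamma>" by (auto simp: arcs_between_def triangle_def)
    from W_eq[OF this] show "W \<sigma> \<rho> \<gamma> =
            (\<Sum>\<sigma>'\<in>arcs_between (D_graph n) i j. \<Sum>\<rho>'\<in>arcs_between (D_graph n) j k. \<Sum>\<gamma>'\<in>arcs_between (D_graph n) k i.
               u \<sigma> \<sigma>' * u \<rho> \<rho>' * u \<gamma> \<gamma>' * D_cell n \<sigma>' \<rho>' \<gamma>')"
      unfolding a[THEN arcs_between_at_most_one] by (simp add: u_def)
  qed
qed

end

theorem theorem6p1:
  fixes n :: nat
  assumes "n \<ge> 5" and "n mod 3 \<noteq> 0"
  shows "orbifold_solution n (D_cell n) \<and>
         (\<forall>W. orbifold_solution n W \<longrightarrow> equivalent_cells (D_graph n) W (D_cell n))"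
  using orbifold_solution_D_cell[OF assms(2)] equivalent_to_D_cell[OF assms(2)] assms(1) by simp

end
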